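(* Let $d\geq1$ and $k\geq1$ be fixed integers. For each $n$ with $2n\geq d+1$, choose uniformly at random a $d$-regular simple graph on the vertex set $\{1,\dots,2n\}$, and let $F_n$ be the expected eigenvalue distribution of the adjacency matrix of its distance-$k$ graph, i.e. $F_n=\mathbb{E}\big[\frac{1}{2n}\sum_{j=1}^{2n}\delta_{\lambda_j}\big]$ where $\lambda_1,\dots,\lambda_{2n}$ are these eigenvalues. Then, as $n\to\infty$, $F_n$ converges (in moments) to the distribution of $A^{[k]}_d$ with respect to the vacuum state.
   Context: The distance-$k$ graph of a graph has the same vertex set, with two vertices adjacent iff their graph distance is exactly $k$. $A^{[k]}_d$ is the adjacency matrix of the distance-$k$ graph of the infinite $d$-regular tree; its distribution with respect to the vacuum state is the probability measure whose $m$-th moment is $((A^{[k]}_d)^m)_{rr}$ for a (any) vertex $r$ of the tree, i.e. the number of closed walks of length $m$ starting at $r$ in that distance-$k$ graph. *)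

theory Defs
  imports
    "HOL-Probability.Probability"
    "Jordan_Normal_Form.Char_Poly"
begin

text \<open>A graph is given by a vertex set and a set of edges, which are two-element sets of vertices.\<close>

definition simple_graph :: "'v set \<Rightarrow> 'v set set \<Rightarrow> bool" where
  "simple_graph V E \<longleftrightarrow> (\<forall>e\<in>E. e \<subseteq> V \<and> card e = 2)"

definition regular_graph :: "nat \<Rightarrow> 'v set \<Rightarrow> 'v set set \<Rightarrow> bool" where
  "regular_graph d V E \<longleftrightarrow>
     simple_graph V E \<and> (\<forall>v\<in>V. finite {e\<in>E. v \<in> e} \<and> card {e\<in>E. v \<in> e} = d)"

text \<open>A walk is the list of its vertices, so a walk of length \<open>m\<close> is a list with \<open>m + 1\<close> entries.\<close>

definition walk :: "'v set \<Rightarrow> 'v set set \<Rightarrow> 'v list \<Rightarrow> bool" where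
  "walk V E xs \<longleftrightarrow> xs \<noteq> [] \<and> set xs \<subseteq> V \<and> successively (\<lambda>u v. {u, v} \<in> E) xs"

definition walks_between :: "'v set \<Rightarrow> 'v set set \<Rightarrow> 'v \<Rightarrow> 'v \<Rightarrow> 'v list set" where
  "walks_between V E u v = {xs. walk V E xs \<and> hd xs = u \<and> last xs = v}"

text \<open>The distance is \<open>\<infinity>\<close> between vertices in different components.\<close>

definition graph_dist :: "'v set \<Rightarrow> 'v set set \<Rightarrow> 'v \<Rightarrow> 'v \<Rightarrow> enat" where
  "graph_dist V E u v = (INF xs \<in> walks_between V E u v. enat (length xs - 1))"

definition distance_graph :: "nat \<Rightarrow> 'v set \<Rightarrow> 'v set set \<Rightarrow> 'v set set" where
  "distance_graph k V E = {{u, v} | u v. u \<in> V \<and> v \<in> V \<and> graph_dist V E u v = enat k}"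

definition connected_graph :: "'v set \<Rightarrow> 'v set set \<Rightarrow> bool" where
  "connected_graph V E \<longleftrightarrow> V \<noteq> {} \<and> (\<forall>u\<in>V. \<forall>v\<in>V. walks_between V E u v \<noteq> {})"

definition acyclic_graph :: "'v set \<Rightarrow> 'v set set \<Rightarrow> bool" where
  "acyclic_graph V E \<longleftrightarrow>
     \<not> (\<exists>xs. walk V E xs \<and> distinct xs \<and> length xs \<ge> 3 \<and> {last xs, hd xs} \<in> E)"

text \<open>
  For \<open>d \<ge> 2\<close> a \<open>d\<close>-regular tree is automatically infinite, and it is unique up to isomorphism;
  for \<open>d = 1\<close> it is a single edge.
\<close>

definition regular_tree :: "nat \<Rightarrow> 'v set \<Rightarrow> 'v set set \<Rightarrow> bool" where
  "regular_tree d V E \<longleftrightarrow> regular_graph d V E \<and> connected_graph V E \<and> acyclic_graph V E"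

definition closed_walks :: "'v set \<Rightarrow> 'v set set \<Rightarrow> 'v \<Rightarrow> nat \<Rightarrow> 'v list set" where
  "closed_walks V E r m = {xs \<in> walks_between V E r r. length xs = m + 1}"

definition vacuum_distribution :: "'v set \<Rightarrow> 'v set set \<Rightarrow> 'v \<Rightarrow> real measure \<Rightarrow> bool" where
  "vacuum_distribution V E r \<mu> \<longleftrightarrow> real_distribution \<mu> \<and>
     (\<forall>m. integrable \<mu> (\<lambda>x. x ^ m) \<and>
          (LINT x|\<mu>. x ^ m) = real (card (closed_walks V E r m)))"

text \<open>Matrix indices start at 0, whereas the vertices are \<open>1, \<dots>, N\<close>.\<close>

definition adjacency_matrix :: "nat \<Rightarrow> nat set set \<Rightarrow> real mat" where
  "adjacency_matrix N E = Matrix.mat N N (\<lambda>(i, j). of_bool ({i + 1, j + 1} \<in> E))"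

text \<open>
  The eigenvalues are counted with multiplicity, as roots of the characteristic polynomial;
  as the matrix is real symmetric, there are \<open>N\<close> of them and all are real. Thus the distribution
  below is \<open>1 / N\<close> times the sum of the point masses at the eigenvalues.
\<close>

definition eigenvalue_distribution :: "nat \<Rightarrow> nat set set \<Rightarrow> real pmf" where
  "eigenvalue_distribution N E = pmf_of_multiset (proots (char_poly (adjacency_matrix N E)))"

text \<open>
  The monadic bind is the mixture, i.e. the expectation of the random measure. The set of
  \<open>d\<close>-regular graphs is nonempty whenever \<open>2 * n \<ge> d + 1\<close>; for the finitely many smaller \<open>n\<close>
  the value is irrelevant.
\<close>

definition expected_eigenvalue_distribution :: "nat \<Rightarrow> nat \<Rightarrow> nat \<Rightarrow> real measure" where
  "expected_eigenvalue_distribution d k n =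
     distr (measure_pmf (bind_pmf (pmf_of_set {E. regular_graph d {1..2 * n} E})
              (\<lambda>E. eigenvalue_distribution (2 * n) (distance_graph k {1..2 * n} E))))
       borel (\<lambda>x. x)"

definition converges_in_moments :: "(nat \<Rightarrow> real measure) \<Rightarrow> real measure \<Rightarrow> bool" where
  "converges_in_moments M \<mu> \<longleftrightarrow>
     (\<forall>m. (\<forall>\<^sub>F n in sequentially. integrable (M n) (\<lambda>x. x ^ m)) \<and>
          integrable \<mu> (\<lambda>x. x ^ m) \<and>
          (\<lambda>n. LINT x|M n. x ^ m) \<longlonglongrightarrow> (LINT x|\<mu>. x ^ m))"

end

theory Submission
  imports Defs "Jordan_Normal_Form.Schur_Decomposition"
begin

unbundle no vec_syntax

text \<open>
  Around a vertex with no short cycle nearby, every vertex at distance \<open>i \<ge> 1\<close> from a given one has one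
  neighbour at distance \<open>i - 1\<close> and \<open>d - 1\<close> neighbours at distance \<open>i + 1\<close>. Hence the number of
  closed walks of length \<open>m\<close> in the distance-\<open>k\<close> graph is a universal function of \<open>d\<close>, \<open>k\<close> and \<open>m\<close>
  there, and in particular agrees with the number for the tree. A switching argument shows that the
  expected number of cycles of length at most \<open>L\<close> in a random \<open>d\<close>-regular graph is bounded, so that
  the expected proportion of the exceptional vertices tends to \<open>0\<close>. As the moments of the eigenvalue
  distribution are normalised traces of powers, that is, averages of numbers of closed walks, they
  converge. All eigenvalues lie in the interval from \<open>- d ^ k\<close> to \<open>d ^ k\<close>, so Helly's selection
  theorem provides a measure with the limiting moments.
\<close>

section \<open>Walks and distances\<close>

definition neighbours :: "'v set set \<Rightarrow> 'v \<Rightarrow> 'v set" where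
  "neighbours E u = {w. {u, w} \<in> E}"

text \<open>The target is a set so that one recursion on the first step serves both closed walks
  (\<open>{r}\<close>) and walks with a free end (\<open>UNIV\<close>).\<close>

definition walks_into :: "'v set \<Rightarrow> 'v set set \<Rightarrow> nat \<Rightarrow> 'v \<Rightarrow> 'v set \<Rightarrow> 'v list set" where
  "walks_into V E m u Z = {xs. walk V E xs \<and> hd xs = u \<and> last xs \<in> Z \<and> length xs = m + 1}"

lemma closed_walks_eq: "closed_walks V E r m = walks_into V E m r {r}"
  by (auto simp: closed_walks_def walks_into_def walks_between_def)

lemma walk_singleton [simp]: "walk V E [u] \<longleftrightarrow> u \<in> V"
  by (simp add: walk_def)

lemma walk_Cons:
  "xs \<noteq> [] \<Longrightarrow> walk V E (u # xs) \<longleftrightarrow> u \<in> V \<and> {u, hd xs} \<in> E \<and> walk V E xs"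
  by (cases xs) (auto simp: walk_def)

lemma walk_append:
  "xs \<noteq> [] \<Longrightarrow> ys \<noteq> [] \<Longrightarrow>
    walk V E (xs @ ys) \<longleftrightarrow> walk V E xs \<and> walk V E ys \<and> {last xs, hd ys} \<in> E"
  by (auto simp: walk_def successively_append_iff)

lemma walk_rev [simp]: "walk V E (rev xs) \<longleftrightarrow> walk V E xs"
  by (auto simp: walk_def successively_rev insert_commute)

lemma walk_hd_last: "walk V E xs \<Longrightarrow> hd xs \<in> V \<and> last xs \<in> V"
  by (auto simp: walk_def)

lemma walks_into_0: "walks_into V E 0 u Z = (if u \<in> V \<inter> Z then {[u]} else {})"
  by (auto simp: walks_into_def length_Suc_conv)

lemma walks_into_Suc:
  "u \<in> V \<Longrightarrow> walks_into V E (Suc m) u Z = (\<Union>x\<in>neighbours E u \<inter> V. (#) u ` walks_into V E m x Z)"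
proof (intro Set.set_eqI iffI)
  fix xs assume u: "u \<in> V" and "xs \<in> walks_into V E (Suc m) u Z"
  hence xs: "walk V E xs" "hd xs = u" "last xs \<in> Z" "length xs = m + 2"
    by (auto simp: walks_into_def)
  then obtain ys where ys: "xs = u # ys" "ys \<noteq> []"
    by (cases xs) (force simp: Suc_length_conv)+
  hence "ys \<in> walks_into V E m (hd ys) Z" "{u, hd ys} \<in> E" "hd ys \<in> V"
    using xs by (auto simp: walks_into_def walk_Cons dest: walk_hd_last)
  thus "xs \<in> (\<Union>x\<in>neighbours E u \<inter> V. (#) u ` walks_into V E m x Z)"
    using ys by (auto simp: neighbours_def)
next
  fix xs assume u: "u \<in> V" and "xs \<in> (\<Union>x\<in>neighbours E u \<inter> V. (#) u ` walks_into V E m x Z)"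
  then obtain ys where "xs = u # ys" "{u, hd ys} \<in> E" "walk V E ys" "last ys \<in> Z" "length ys = m + 1"
    by (auto simp: walks_into_def neighbours_def)
  thus "xs \<in> walks_into V E (Suc m) u Z" using u
    by (cases "ys = []") (auto simp: walks_into_def walk_Cons)
qed

lemma walks_into_finite_card:
  assumes "\<And>u. u \<in> V \<Longrightarrow> finite (neighbours E u)" and "u \<in> V"
  shows "finite (walks_into V E m u Z)"
    and "card (walks_into V E (Suc m) u Z) = (\<Sum>x\<in>neighbours E u \<inter> V. card (walks_into V E m x Z))"
proof -
  have fin: "finite (walks_into V E m u Z)" if "u \<in> V" for m u
    using that by (induction m arbitrary: u) (auto simp: walks_into_0 walks_into_Suc assms(1))
  show "finite (walks_into V E m u Z)" using fin assms by blast
  have "card (walks_into V E (Suc m) u Z) =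
      (\<Sum>x\<in>neighbours E u \<inter> V. card ((#) u ` walks_into V E m x Z))"
    unfolding walks_into_Suc[OF assms(2)]
    by (rule card_UN_disjoint) (use assms fin in \<open>auto simp: walks_into_def\<close>)
  thus "card (walks_into V E (Suc m) u Z) = (\<Sum>x\<in>neighbours E u \<inter> V. card (walks_into V E m x Z))"
    by (simp add: card_image)
qed

lemma card_walks_into_le:
  assumes "\<And>u. u \<in> V \<Longrightarrow> finite (neighbours E u)"
    and "\<And>u. u \<in> V \<Longrightarrow> card (neighbours E u \<inter> V) \<le> D" and "u \<in> V"
  shows "card (walks_into V E m u Z) \<le> D ^ m"
  using assms(3)
proof (induction m arbitrary: u)
  case 0
  thus ?case by (simp add: walks_into_0)
next
  case (Suc m)
  have "card (walks_into V E (Suc m) u Z) \<le> (\<Sum>x\<in>neighbours E u \<inter> V. D ^ m)"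
    by (subst walks_into_finite_card(2)[OF assms(1) Suc.prems], assumption)
       (rule sum_mono, use Suc.IH in auto)
  also have "\<dots> \<le> D * D ^ m" using assms(2)[OF Suc.prems] by simp
  finally show ?case by simp
qed

lemma walks_into_rev:
  "walks_into V E m u {v} \<noteq> {} \<longleftrightarrow> walks_into V E m v {u} \<noteq> {}"
proof -
  have "rev xs \<in> walks_into V E m v {u}" if "xs \<in> walks_into V E m u {v}" for u v xs
    using that by (cases "xs = []") (auto simp: walks_into_def hd_rev last_rev)
  thus ?thesis by blast
qed

section \<open>Distances through shortest walks\<close>

lemma graph_dist_eq_enat_iff:
  "graph_dist V E u v = enat i \<longleftrightarrow>
     walks_into V E i u {v} \<noteq> {} \<and> (\<forall>j<i. walks_into V E j u {v} = {})"
proof -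
  let ?L = "(\<lambda>xs. enat (length xs - 1)) ` walks_between V E u v"
  have mem: "enat j \<in> ?L \<longleftrightarrow> walks_into V E j u {v} \<noteq> {}" for j
    by (force simp: walks_into_def walks_between_def walk_def image_iff)
  have sub: "\<exists>j. x = enat j" if "x \<in> ?L" for x using that by auto
  show ?thesis
  proof
    assume d: "graph_dist V E u v = enat i"
    \<comment> \<open>The infimum of the empty set is \<open>\<infinity>\<close>, so a finite
      distance yields a walk; by well-ordering the infimum is attained.\<close>
    hence ne: "?L \<noteq> {}" by (auto simp: graph_dist_def top_enat_def)
    have "Inf ?L \<in> ?L" using ne by (meson LeastI ex_in_conv Inf_enat_def wellorder_InfI)
    hence "enat i \<in> ?L" using d by (simp add: graph_dist_def)
    moreover have "enat j \<notin> ?L" if "j < i" for j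
      using d that Inf_lower[of "enat j" ?L] by (auto simp: graph_dist_def)
    ultimately show "walks_into V E i u {v} \<noteq> {} \<and> (\<forall>j<i. walks_into V E j u {v} = {})"
      using mem by blast
  next
    assume w: "walks_into V E i u {v} \<noteq> {} \<and> (\<forall>j<i. walks_into V E j u {v} = {})"
    hence "Inf ?L \<le> enat i" using mem by (intro Inf_lower) blast
    moreover have "enat i \<le> Inf ?L"
    proof (rule Inf_greatest)
      fix x assume x: "x \<in> ?L"
      then obtain j where "x = enat j" using sub by blast
      thus "enat i \<le> x" using x w mem[of j] by (cases "j < i") auto
    qed
    ultimately show "graph_dist V E u v = enat i" by (simp add: graph_dist_def)
  qed
qed

lemma graph_dist_commute: "graph_dist V E u v = graph_dist V E v u"
proof -
  have "graph_dist V E u v = enat i \<longleftrightarrow> graph_dist V E v u = enat i" for i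
    unfolding graph_dist_eq_enat_iff using walks_into_rev[of V E _ u v] by simp
  thus ?thesis by (metis not_enat_eq)
qed

lemma graph_dist_mem: "graph_dist V E u v = enat i \<Longrightarrow> u \<in> V \<and> v \<in> V"
  unfolding graph_dist_eq_enat_iff by (auto simp: walks_into_def dest: walk_hd_last)

lemma graph_dist_le_walk:
  assumes "walks_into V E j u {v} \<noteq> {}"
  shows "\<exists>i\<le>j. graph_dist V E u v = enat i"
proof -
  let ?P = "\<lambda>i. walks_into V E i u {v} \<noteq> {}"
  have "?P (LEAST i. ?P i)" "(LEAST i. ?P i) \<le> j" using LeastI[of ?P, OF assms] Least_le[of ?P, OF assms] by auto
  moreover have "\<not> ?P i" if "i < (LEAST i. ?P i)" for i using that not_less_Least by blast
  ultimately show ?thesis unfolding graph_dist_eq_enat_iff by blast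
qed

lemma graph_dist_0_iff: "graph_dist V E u v = enat 0 \<longleftrightarrow> u = v \<and> u \<in> V"
  unfolding graph_dist_eq_enat_iff by (auto simp: walks_into_0)

lemma walks_into_Cons_neighbour:
  assumes "u \<in> V" "x \<in> neighbours E u" "walks_into V E j x Z \<noteq> {}"
  shows "walks_into V E (Suc j) u Z \<noteq> {}"
proof -
  have "x \<in> V" using assms(3) by (auto simp: walks_into_def dest: walk_hd_last)
  thus ?thesis using assms by (auto simp: walks_into_Suc)
qed

lemma graph_dist_neighbour:
  assumes u: "u \<in> V" and x: "x \<in> V" "x \<in> neighbours E u" and d: "graph_dist V E u y = enat i"
  shows "\<exists>j. graph_dist V E x y = enat j \<and> j \<le> Suc i \<and> i \<le> Suc j"
proof -
  have u': "u \<in> neighbours E x" using x by (auto simp: neighbours_def insert_commute)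
  have "walks_into V E (Suc i) x {y} \<noteq> {}"
    by (rule walks_into_Cons_neighbour[OF x(1) u']) (use d in \<open>simp add: graph_dist_eq_enat_iff\<close>)
  then obtain j where j: "j \<le> Suc i" "graph_dist V E x y = enat j"
    using graph_dist_le_walk by metis
  have "walks_into V E (Suc j) u {y} \<noteq> {}"
    by (rule walks_into_Cons_neighbour[OF u x(2)]) (use j in \<open>simp add: graph_dist_eq_enat_iff\<close>)
  hence "i \<le> Suc j" using d unfolding graph_dist_eq_enat_iff by (meson not_less)
  thus ?thesis using j by blast
qed

lemma graph_dist_Suc_neighbour:
  assumes d: "graph_dist V E u y = enat (Suc i)"
  shows "\<exists>x\<in>neighbours E u \<inter> V. graph_dist V E x y = enat i"
proof -
  have u: "u \<in> V" using graph_dist_mem[OF d] by simp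
  have "walks_into V E (Suc i) u {y} \<noteq> {}" using d by (simp add: graph_dist_eq_enat_iff)
  then obtain x where x: "x \<in> neighbours E u \<inter> V" "walks_into V E i x {y} \<noteq> {}"
    by (auto simp: walks_into_Suc[OF u])
  then obtain j where j: "j \<le> i" "graph_dist V E x y = enat j"
    using graph_dist_le_walk by metis
  have "Suc i \<le> Suc j" using graph_dist_neighbour[OF u _ _ d, of x] x j by auto
  thus ?thesis using x j by auto
qed

text \<open>Each step of a shortest walk comes strictly closer to \<open>y\<close>, so no vertex
  recurs. The bound on the later vertices drives the induction and keeps the path away from any
  vertex at least as far from \<open>y\<close> as its start.\<close>

lemma distinct_geodesic:
  assumes "graph_dist V E u y = enat i"
  shows "\<exists>p. u # p \<in> walks_into V E i u {y} \<and> distinct (u # p) \<and>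
    (\<forall>z\<in>set p. \<exists>j<i. graph_dist V E z y = enat j)"
  using assms
proof (induction i arbitrary: u)
  case 0
  thus ?case by (intro exI[of _ "[]"]) (auto simp: graph_dist_0_iff walks_into_0)
next
  case (Suc i)
  then obtain x where x: "x \<in> neighbours E u \<inter> V" "graph_dist V E x y = enat i"
    using graph_dist_Suc_neighbour by metis
  obtain p where p: "x # p \<in> walks_into V E i x {y}" "distinct (x # p)"
    "\<forall>z\<in>set p. \<exists>j<i. graph_dist V E z y = enat j" using Suc.IH[OF x(2)] by blast
  have u: "u \<in> V" using graph_dist_mem[OF Suc.prems] by simp
  have all: "\<forall>z\<in>set (x # p). \<exists>j<Suc i. graph_dist V E z y = enat j"
    using p(3) x(2) by (auto intro: less_SucI)
  hence "u \<notin> set (x # p)" using Suc.prems by force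
  thus ?case using p all u x
    by (intro exI[of _ "x # p"]) (auto simp: walks_into_Suc)
qed

text \<open>The list has a marked start, so a cycle is counted once for each starting vertex and
  direction, which is harmless in upper bounds.\<close>

definition graph_cycle :: "'v set \<Rightarrow> 'v set set \<Rightarrow> 'v list \<Rightarrow> bool" where
  "graph_cycle V E xs \<longleftrightarrow> walk V E xs \<and> distinct xs \<and> length xs \<ge> 3 \<and> {last xs, hd xs} \<in> E"

text \<open>Follow \<open>p\<close> to its first vertex \<open>z\<close> on \<open>q\<close>, then
  return along \<open>q\<close>; by the choice of \<open>z\<close> no vertex repeats.\<close>

lemma cycle_of_two_paths:
  assumes p: "walk V E (u # p)" "distinct (u # p)" "p \<noteq> []"
    and q: "walk V E (u # q)" "distinct (u # q)" "q \<noteq> []"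
    and pq: "hd p \<noteq> hd q" "last p = last q"
  shows "\<exists>xs. graph_cycle V E xs \<and> hd xs = u \<and> length xs \<le> length p + length q"
proof -
  have "last p \<in> set p" using p(3) by simp
  moreover have "last p \<in> set q" unfolding pq(2) using q(3) by simp
  ultimately have "\<exists>z\<in>set p. z \<in> set q" by blast
  then obtain p1 z p2 where p': "p = p1 @ z # p2" "z \<in> set q" "\<forall>y\<in>set p1. y \<notin> set q"
    using split_list_first_prop[of p "\<lambda>z. z \<in> set q"] by blast
  obtain q1 q2 where q': "q = q1 @ z # q2" using p'(2) by (meson split_list)
  let ?xs = "(u # p1) @ z # rev q1"
  have wp: "walk V E (u # p1 @ [z])"
  proof (cases "p2 = []")
    case False
    thus ?thesis using p(1) p' walk_append[of "u # p1 @ [z]" p2 V E] by simp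
  qed (use p p' in simp)
  have wq: "walk V E (u # q1 @ [z])"
  proof (cases "q2 = []")
    case False
    thus ?thesis using q(1) q' walk_append[of "u # q1 @ [z]" q2 V E] by simp
  qed (use q q' in simp)
  have "walk V E (rev (q1 @ [z]))" using wq walk_Cons[of "q1 @ [z]" V E u] by (simp only: walk_rev) simp
  hence w: "walk V E ?xs"
    using wp walk_append[of "u # p1" "[z]" V E] walk_append[of "u # p1" "z # rev q1" V E] by simp
  have "distinct ?xs" using p q p' q' by auto
  \<comment> \<open>Were \<open>p1\<close> and \<open>q1\<close> both empty, \<open>p\<close> and
    \<open>q\<close> would both start at \<open>z\<close>, against
    \<open>hd p \<noteq> hd q\<close>.\<close>
  moreover have "length ?xs \<ge> 3" using pq p' q' by (cases p1; cases q1) auto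
  moreover have "{last ?xs, hd ?xs} \<in> E"
  proof (cases q1)
    case Nil
    thus ?thesis using wq by (simp add: walk_Cons insert_commute)
  next
    case (Cons a list)
    thus ?thesis using wq by (simp add: walk_Cons insert_commute)
  qed
  ultimately have "graph_cycle V E ?xs" using w by (simp add: graph_cycle_def)
  thus ?thesis using p' q' by (intro exI[of _ ?xs]) simp
qed

section \<open>Spheres as neighbourhoods in the distance graph\<close>

definition dist_sphere :: "'v set \<Rightarrow> 'v set set \<Rightarrow> nat \<Rightarrow> 'v \<Rightarrow> 'v set" where
  "dist_sphere V E j u = {y. graph_dist V E u y = enat j}"

lemma dist_sphere_0: "u \<in> V \<Longrightarrow> dist_sphere V E 0 u = {u}"
  by (auto simp: dist_sphere_def graph_dist_0_iff)

lemma dist_sphere_subset: "dist_sphere V E j u \<subseteq> V"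
  using graph_dist_mem by (fastforce simp: dist_sphere_def)

lemma neighbours_distance_graph:
  assumes "u \<in> V"
  shows "neighbours (distance_graph k V E) u = dist_sphere V E k u"
proof (intro Set.set_eqI iffI)
  fix w assume "w \<in> neighbours (distance_graph k V E) u"
  then obtain a b where ab: "{u, w} = {a, b}" "graph_dist V E a b = enat k"
    by (auto simp: neighbours_def distance_graph_def)
  from ab(1) consider "u = a" "w = b" | "u = b" "w = a" by (auto simp: doubleton_eq_iff)
  thus "w \<in> dist_sphere V E k u"
    by cases (use ab(2) graph_dist_commute[of V E a b] in \<open>simp_all add: dist_sphere_def\<close>)
next
  fix w assume "w \<in> dist_sphere V E k u"
  hence "graph_dist V E u w = enat k" by (simp add: dist_sphere_def)
  thus "w \<in> neighbours (distance_graph k V E) u"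
    using graph_dist_mem[of V E u w k] by (auto simp: neighbours_def distance_graph_def)
qed

section \<open>Regular graphs without short cycles\<close>

text \<open>
  On functions of the distance to a root, the adjacency operator of the \<open>d\<close>-regular tree acts as
  \<open>radial_adj\<close>. Since it maps the distance-\<open>j\<close> operator to the distance-\<open>(j + 1)\<close> operator plus
  \<open>d - 1\<close> (for \<open>j = 1\<close>: \<open>d\<close>) times the distance-\<open>(j - 1)\<close> operator, the latter are the polynomials
  \<open>radial_sphere\<close> in it.
\<close>

definition radial_adj :: "nat \<Rightarrow> (nat \<Rightarrow> real) \<Rightarrow> nat \<Rightarrow> real" where
  "radial_adj d g i =
     (case i of 0 \<Rightarrow> real d * g 1 | Suc l \<Rightarrow> g l + (real d - 1) * g (Suc (Suc l)))"

fun radial_sphere :: "nat \<Rightarrow> nat \<Rightarrow> (nat \<Rightarrow> real) \<Rightarrow> nat \<Rightarrow> real" where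
  "radial_sphere d 0 g = g"
| "radial_sphere d (Suc 0) g = radial_adj d g"
| "radial_sphere d (Suc (Suc j)) g = (\<lambda>i. radial_adj d (radial_sphere d (Suc j) g) i -
     (if j = 0 then real d else real d - 1) * radial_sphere d j g i)"

text \<open>The distance-\<open>k\<close> operator, restricted to radial functions, is applied
  \<open>m\<close> times to the indicator of the root and evaluated at the root. The closed-walk
  counts of the tree and of the random graph are both compared with this value.\<close>

definition tree_moment :: "nat \<Rightarrow> nat \<Rightarrow> nat \<Rightarrow> real" where
  "tree_moment d k m = (radial_sphere d k ^^ m) (\<lambda>i. of_bool (i = 0)) 0"

definition short_cycle_at :: "'v set \<Rightarrow> 'v set set \<Rightarrow> nat \<Rightarrow> 'v \<Rightarrow> bool" where
  "short_cycle_at V E L u \<longleftrightarrow> (\<exists>xs. graph_cycle V E xs \<and> hd xs = u \<and> length xs \<le> L)"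

text \<open>A walk from the cycle to \<open>v\<close> is asked for instead of a distance bound,
  since walks from a given vertex are easily counted.\<close>

definition short_cycle_near :: "'v set \<Rightarrow> 'v set set \<Rightarrow> nat \<Rightarrow> 'v \<Rightarrow> bool" where
  "short_cycle_near V E L v \<longleftrightarrow>
     (\<exists>i u. i \<le> L \<and> walks_into V E i u {v} \<noteq> {} \<and> short_cycle_at V E L u)"

section \<open>Sums over neighbours and spheres in a regular graph\<close>

locale regular =
  fixes d :: nat and V :: "'v set" and E :: "'v set set"
  assumes regular: "regular_graph d V E"
begin

lemma edge: "{u, w} \<in> E \<Longrightarrow> u \<in> V \<and> w \<in> V \<and> u \<noteq> w"
  using regular by (fastforce simp: regular_graph_def simple_graph_def)

lemma neighbours_subset: "neighbours E u \<subseteq> V"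
  using edge by (auto simp: neighbours_def)

lemma neighbours_finite_card:
  assumes u: "u \<in> V"
  shows "finite (neighbours E u)" "card (neighbours E u) = d"
proof -
  have "{e \<in> E. u \<in> e} = (\<lambda>w. {u, w}) ` neighbours E u"
  proof (intro Set.set_eqI iffI)
    fix e assume e: "e \<in> {e \<in> E. u \<in> e}"
    hence "card e = 2" using regular by (auto simp: regular_graph_def simple_graph_def)
    then obtain w where "e = {u, w}" using e by (auto simp: card_2_iff)
    thus "e \<in> (\<lambda>w. {u, w}) ` neighbours E u" using e by (auto simp: neighbours_def)
  qed (auto simp: neighbours_def)
  moreover have "inj_on (\<lambda>w. {u, w}) (neighbours E u)"
    by (auto simp: inj_on_def doubleton_eq_iff)
  moreover have "finite {e \<in> E. u \<in> e}" "card {e \<in> E. u \<in> e} = d"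
    using regular u by (auto simp: regular_graph_def)
  ultimately show "finite (neighbours E u)" "card (neighbours E u) = d"
    by (auto simp: card_image finite_image_iff)
qed

lemma card_walks_into_le_degree: "u \<in> V \<Longrightarrow> card (walks_into V E m u Z) \<le> d ^ m"
  by (rule card_walks_into_le) (simp_all add: neighbours_finite_card neighbours_subset Int_absorb2)

lemma dist_sphere_Suc_subset: "u \<in> V \<Longrightarrow> dist_sphere V E (Suc j) u \<subseteq> (\<Union>x\<in>neighbours E u. dist_sphere V E j x)"
  using graph_dist_Suc_neighbour by (fastforce simp: dist_sphere_def)

lemma dist_sphere_finite_card:
  assumes "u \<in> V"
  shows "finite (dist_sphere V E j u) \<and> card (dist_sphere V E j u) \<le> d ^ j"
  using assms
proof (induction j arbitrary: u)
  case 0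
  thus ?case by (simp add: dist_sphere_0)
next
  case (Suc j)
  have nb: "\<And>x. x \<in> neighbours E u \<Longrightarrow> x \<in> V" using neighbours_subset by blast
  have fin: "finite (\<Union>x\<in>neighbours E u. dist_sphere V E j x)"
    using Suc.IH nb neighbours_finite_card[OF Suc.prems] by auto
  have "card (dist_sphere V E (Suc j) u) \<le> card (\<Union>x\<in>neighbours E u. dist_sphere V E j x)"
    by (rule card_mono[OF fin dist_sphere_Suc_subset[OF Suc.prems]])
  also have "\<dots> \<le> (\<Sum>x\<in>neighbours E u. card (dist_sphere V E j x))"
    by (rule card_UN_le) (use neighbours_finite_card[OF Suc.prems] in auto)
  also have "\<dots> \<le> (\<Sum>x\<in>neighbours E u. d ^ j)"
    by (rule sum_mono) (use Suc.IH nb in auto)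
  also have "\<dots> = d ^ Suc j" using neighbours_finite_card[OF Suc.prems] by simp
  finally show ?case using finite_subset[OF dist_sphere_Suc_subset[OF Suc.prems] fin] by simp
qed

text \<open>Another neighbour at distance at most \<open>i + 1\<close> from \<open>y\<close> would
  give a second path from \<open>u\<close> to \<open>y\<close>; the two paths, of lengths at most
  \<open>i + 2\<close> and \<open>i + 1\<close>, contain a cycle through \<open>u\<close> of length
  at most \<open>2 * i + 3\<close>. This also excludes neighbours at the same distance as
  \<open>u\<close>.\<close>

lemma unique_closer_neighbour:
  assumes d: "graph_dist V E u y = enat (Suc i)"
    and nc: "\<not> short_cycle_at V E (2 * i + 3) u"
  shows "\<exists>x0\<in>neighbours E u. graph_dist V E x0 y = enat i \<and>
           (\<forall>x\<in>neighbours E u - {x0}. graph_dist V E x y = enat (Suc (Suc i)))"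
proof -
  have u: "u \<in> V" using graph_dist_mem[OF d] by simp
  obtain x0 where x0: "x0 \<in> neighbours E u \<inter> V" "graph_dist V E x0 y = enat i"
    using graph_dist_Suc_neighbour[OF d] by blast
  have path: "\<exists>p. walk V E (u # x # p) \<and> distinct (u # x # p) \<and> last (x # p) = y \<and> length p = j"
    if x: "x \<in> neighbours E u \<inter> V" and dx: "graph_dist V E x y = enat j" and j: "j \<le> Suc i" for x j
  proof -
    obtain p where p: "x # p \<in> walks_into V E j x {y}" "distinct (x # p)"
      "\<forall>z\<in>set p. \<exists>l<j. graph_dist V E z y = enat l" using distinct_geodesic[OF dx] by blast
    \<comment> \<open>After \<open>x\<close> the geodesic has distances below
      \<open>j \<le> Suc i\<close>, whereas \<open>u\<close> has distance \<open>Suc i\<close>, so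
      \<open>u\<close> can be put in front without repetition.\<close>
    have "u \<notin> set p" using p(3) d j by force
    moreover have "u \<noteq> x" using x edge[of u x] by (auto simp: neighbours_def)
    ultimately show ?thesis using p x u
      by (intro exI[of _ p]) (auto simp: walks_into_def walk_Cons neighbours_def)
  qed
  have "graph_dist V E x y = enat (Suc (Suc i))" if x: "x \<in> neighbours E u - {x0}" for x
  proof (rule ccontr)
    assume ne: "graph_dist V E x y \<noteq> enat (Suc (Suc i))"
    have xV: "x \<in> neighbours E u \<inter> V" using x neighbours_subset by blast
    then obtain j where j: "graph_dist V E x y = enat j" "j \<le> Suc (Suc i)"
      using graph_dist_neighbour[OF u _ _ d] by blast
    hence j': "j \<le> Suc i" using ne by (cases "j = Suc (Suc i)") auto
    obtain p where p: "walk V E (u # x # p)" "distinct (u # x # p)" "last (x # p) = y" "length p = j"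
      using path[OF xV j(1) j'] by blast
    obtain q where q: "walk V E (u # x0 # q)" "distinct (u # x0 # q)" "last (x0 # q) = y" "length q = i"
      using path[OF x0] by auto
    have "\<exists>xs. graph_cycle V E xs \<and> hd xs = u \<and> length xs \<le> length (x # p) + length (x0 # q)"
      by (rule cycle_of_two_paths) (use p q x in auto)
    thus False using nc p q j' by (auto simp: short_cycle_at_def)
  qed
  thus ?thesis using x0 by blast
qed

text \<open>One neighbour of \<open>u\<close> has distance \<open>i - 1\<close> and
  \<open>d - 1\<close> have distance \<open>i + 1\<close>, or all \<open>d\<close> have distance
  \<open>1\<close> if \<open>i = 0\<close>. The cycle bound is that of
  \<open>unique_closer_neighbour\<close> with \<open>i - 1\<close> in place of
  \<open>i\<close>.\<close>

lemma sum_neighbours_radial: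
  assumes d: "graph_dist V E u y = enat i"
    and nc: "\<not> short_cycle_at V E (2 * i + 1) u"
    and F: "\<And>x l. x \<in> neighbours E u \<Longrightarrow> graph_dist V E x y = enat l \<Longrightarrow> F x = g l"
  shows "(\<Sum>x\<in>neighbours E u. F x) = radial_adj d g i"
proof (cases i)
  case 0
  hence u: "u = y" "u \<in> V" using d by (auto simp: graph_dist_0_iff)
  have "F x = g 1" if x: "x \<in> neighbours E u" for x
  proof -
    have xV: "x \<in> V" "x \<noteq> u" using x edge[of u x] by (auto simp: neighbours_def)
    then obtain l where l: "graph_dist V E x y = enat l" "l \<le> 1"
      using graph_dist_neighbour[OF u(2) xV(1) x d] 0 by auto
    have "l \<noteq> 0" using l(1) u xV graph_dist_0_iff[of V E x y] by metis
    thus ?thesis using F[OF x l(1)] l(2) by (simp add: le_Suc_eq)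
  qed
  thus ?thesis using 0 neighbours_finite_card[OF u(2)] by (simp add: radial_adj_def)
next
  case (Suc l)
  have u: "u \<in> V" using graph_dist_mem[OF d] by simp
  obtain x0 where x0: "x0 \<in> neighbours E u" "graph_dist V E x0 y = enat l"
    "\<forall>x\<in>neighbours E u - {x0}. graph_dist V E x y = enat (Suc (Suc l))"
    using unique_closer_neighbour[of u y l] d nc Suc by (auto simp: eval_nat_numeral)
  note fin = neighbours_finite_card[OF u]
  have "(\<Sum>x\<in>neighbours E u. F x) = F x0 + (\<Sum>x\<in>neighbours E u - {x0}. F x)"
    by (rule sum.remove[OF fin(1) x0(1)])
  also have "(\<Sum>x\<in>neighbours E u - {x0}. F x) = (\<Sum>x\<in>neighbours E u - {x0}. g (Suc (Suc l)))"
    using x0(3) F by (intro sum.cong) auto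
  also have "\<dots> = (real d - 1) * g (Suc (Suc l))"
    using fin x0(1) card_gt_0_iff[of "neighbours E u"] by (auto simp: of_nat_diff)
  finally show ?thesis using F[OF x0(1,2)] Suc by (simp add: radial_adj_def)
qed

text \<open>Double counting: each \<open>y\<close> is weighted by the number of neighbours of
  \<open>u\<close> at distance \<open>j + 1\<close> from \<open>y\<close>, which is \<open>1\<close>
  on the outer sphere, the stated constant on the inner one and \<open>0\<close> in between. In
  operator form this is the recursion of \<open>radial_sphere\<close>.\<close>

lemma sum_neighbours_spheres:
  fixes F :: "'v \<Rightarrow> real"
  assumes u: "u \<in> V" and nc: "\<not> short_cycle_at V E (2 * j + 5) u"
  shows "(\<Sum>x\<in>neighbours E u. \<Sum>y\<in>dist_sphere V E (Suc j) x. F y) =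
    (\<Sum>y\<in>dist_sphere V E (Suc (Suc j)) u. F y) +
    (if j = 0 then real d else real d - 1) * (\<Sum>y\<in>dist_sphere V E j u. F y)"
proof -
  let ?S = "\<lambda>i. dist_sphere V E i u" and ?c = "if j = 0 then real d else real d - 1"
  define W where "W = ?S j \<union> ?S (Suc j) \<union> ?S (Suc (Suc j))"
  have finW: "finite W" unfolding W_def using dist_sphere_finite_card[OF u] by auto
  have count: "(\<Sum>x\<in>neighbours E u. of_bool (y \<in> dist_sphere V E (Suc j) x)) =
      of_bool (y \<in> ?S (Suc (Suc j))) + ?c * of_bool (y \<in> ?S j)" if y: "y \<in> W" for y
  proof -
    obtain i where i: "graph_dist V E u y = enat i" "i = j \<or> i = Suc j \<or> i = Suc (Suc j)"
      using y by (auto simp: W_def dist_sphere_def)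
    \<comment> \<open>For fixed \<open>y\<close> the count is a neighbour sum of the indicator of
      distance \<open>j + 1\<close> to \<open>y\<close>, a radial function.\<close>
    have "(\<Sum>x\<in>neighbours E u. of_bool (y \<in> dist_sphere V E (Suc j) x)) =
        radial_adj d (\<lambda>l. of_bool (l = Suc j)) i"
      by (rule sum_neighbours_radial[OF i(1)])
         (use nc i(2) in \<open>auto simp: dist_sphere_def short_cycle_at_def\<close>)
    thus ?thesis using i by (auto simp: radial_adj_def dist_sphere_def split: nat.split)
  qed
  have "(\<Sum>x\<in>neighbours E u. \<Sum>y\<in>dist_sphere V E (Suc j) x. F y) =
      (\<Sum>x\<in>neighbours E u. \<Sum>y\<in>W. of_bool (y \<in> dist_sphere V E (Suc j) x) * F y)"
  proof (rule sum.cong[OF refl])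
    fix x assume x: "x \<in> neighbours E u"
    have xV: "x \<in> V" using x neighbours_subset by blast
    have ux: "u \<in> neighbours E x" using x by (auto simp: neighbours_def insert_commute)
    have "dist_sphere V E (Suc j) x \<subseteq> W"
    proof
      fix y assume "y \<in> dist_sphere V E (Suc j) x"
      hence "graph_dist V E x y = enat (Suc j)" by (simp add: dist_sphere_def)
      from graph_dist_neighbour[OF xV u ux this] show "y \<in> W"
        by (auto simp: W_def dist_sphere_def le_Suc_eq)
    qed
    thus "(\<Sum>y\<in>dist_sphere V E (Suc j) x. F y) = (\<Sum>y\<in>W. of_bool (y \<in> dist_sphere V E (Suc j) x) * F y)"
      by (intro sum.mono_neutral_cong_left finW) auto
  qed
  also have "\<dots> = (\<Sum>y\<in>W. (\<Sum>x\<in>neighbours E u. of_bool (y \<in> dist_sphere V E (Suc j) x)) * F y)"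
    by (subst sum.swap) (simp add: sum_distrib_right)
  also have "\<dots> = (\<Sum>y\<in>W. of_bool (y \<in> ?S (Suc (Suc j))) * F y + ?c * (of_bool (y \<in> ?S j) * F y))"
    by (rule sum.cong[OF refl]) (simp only: count distrib_right mult.assoc)
  also have "\<dots> = (\<Sum>y\<in>W. of_bool (y \<in> ?S (Suc (Suc j))) * F y) + ?c * (\<Sum>y\<in>W. of_bool (y \<in> ?S j) * F y)"
    by (simp only: sum.distrib sum_distrib_left)
  also have "(\<Sum>y\<in>W. of_bool (y \<in> ?S (Suc (Suc j))) * F y) = (\<Sum>y\<in>?S (Suc (Suc j)). F y)"
    by (rule sum.mono_neutral_cong_right[OF finW]) (auto simp: W_def)
  also have "(\<Sum>y\<in>W. of_bool (y \<in> ?S j) * F y) = (\<Sum>y\<in>?S j. F y)"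
    by (rule sum.mono_neutral_cong_right[OF finW]) (auto simp: W_def)
  finally show ?thesis .
qed

text \<open>Two-step induction along \<open>radial_sphere\<close>, with
  \<open>sum_neighbours_spheres\<close> solved for the outermost sphere. Passing to a neighbour of
  \<open>u\<close> trades one unit of \<open>j\<close> for at most one of \<open>i\<close>, so all
  vertices met stay within distance \<open>i + j\<close> of \<open>v\<close>.\<close>

lemma sum_sphere_radial:
  assumes nc: "\<not> short_cycle_near V E L v"
    and i: "graph_dist V E u v = enat i" and ij: "2 * (i + j) + 1 \<le> L"
    and F: "\<And>x l. l \<le> i + j \<Longrightarrow> graph_dist V E x v = enat l \<Longrightarrow> F x = g l"
  shows "(\<Sum>x\<in>dist_sphere V E j u. F x) = radial_sphere d j g i"
proof -
  have nc': "\<not> short_cycle_at V E K x"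
    if "graph_dist V E x v = enat l" "l \<le> L" "K \<le> L" for x l K
    using nc that order_trans[of _ K L]
    unfolding short_cycle_near_def short_cycle_at_def graph_dist_eq_enat_iff by metis
  show ?thesis using i ij F
  proof (induction j arbitrary: u i rule: induct_nat_012)
    case 0
    thus ?case using graph_dist_mem[OF 0(1)] by (simp add: dist_sphere_0)
  next
    case 1
    have u: "u \<in> V" using graph_dist_mem[OF 1(1)] by simp
    have "dist_sphere V E (Suc 0) u = neighbours E u"
    proof (intro Set.set_eqI iffI)
      fix x assume x: "x \<in> dist_sphere V E (Suc 0) u"
      hence "x \<in> (\<Union>x\<in>neighbours E u. dist_sphere V E 0 x)" using dist_sphere_Suc_subset[OF u] by blast
      thus "x \<in> neighbours E u" by (auto simp: dist_sphere_def graph_dist_0_iff)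
    next
      fix x assume x: "x \<in> neighbours E u"
      have xV: "x \<in> V" "x \<noteq> u" using x edge[of u x] by (auto simp: neighbours_def)
      have "graph_dist V E u u = enat 0" using u by (simp add: graph_dist_0_iff)
      from graph_dist_neighbour[OF u xV(1) x this] obtain l
        where l: "graph_dist V E x u = enat l" "l \<le> Suc 0" by blast
      have "l \<noteq> 0" using l(1) xV graph_dist_0_iff[of V E x u] by metis
      hence "l = Suc 0" using l(2) by simp
      thus "x \<in> dist_sphere V E (Suc 0) u" using l(1) by (simp add: dist_sphere_def graph_dist_commute)
    qed
    moreover have "(\<Sum>x\<in>neighbours E u. F x) = radial_adj d g i"
    proof (rule sum_neighbours_radial[OF 1(1)])
      show "\<not> short_cycle_at V E (2 * i + 1) u" using nc'[OF 1(1)] 1(2) by simp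
      fix x l assume x: "x \<in> neighbours E u" "graph_dist V E x v = enat l"
      then obtain l' where "graph_dist V E x v = enat l'" "l' \<le> Suc i"
        using graph_dist_neighbour[OF u _ x(1) 1(1)] neighbours_subset by blast
      thus "F x = g l" using x 1(3) by simp
    qed
    ultimately show ?case by simp
  next
    case (ge2 j)
    have u: "u \<in> V" using graph_dist_mem[OF ge2(3)] by simp
    have "(\<Sum>x\<in>neighbours E u. \<Sum>y\<in>dist_sphere V E (Suc j) x. F y) =
        radial_adj d (radial_sphere d (Suc j) g) i"
    proof (rule sum_neighbours_radial[OF ge2(3)])
      show "\<not> short_cycle_at V E (2 * i + 1) u" using nc'[OF ge2(3)] ge2(4) by simp
      fix x l assume x: "x \<in> neighbours E u" "graph_dist V E x v = enat l"
      then obtain l' where "graph_dist V E x v = enat l'" "l' \<le> Suc i"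
        using graph_dist_neighbour[OF u _ x(1) ge2(3)] neighbours_subset by blast
      hence "l \<le> Suc i" using x by simp
      thus "(\<Sum>y\<in>dist_sphere V E (Suc j) x. F y) = radial_sphere d (Suc j) g l"
        using ge2(4,5) by (intro ge2(2)[OF x(2)]) auto
    qed
    moreover have "\<not> short_cycle_at V E (2 * j + 5) u" using nc'[OF ge2(3)] ge2(4) by simp
    ultimately have "(\<Sum>y\<in>dist_sphere V E (Suc (Suc j)) u. F y) =
        radial_adj d (radial_sphere d (Suc j) g) i -
        (if j = 0 then real d else real d - 1) * (\<Sum>y\<in>dist_sphere V E j u. F y)"
      using sum_neighbours_spheres[OF u, of j F] by simp
    also have "(\<Sum>y\<in>dist_sphere V E j u. F y) = radial_sphere d j g i"
      using ge2(4,5) by (intro ge2(1)[OF ge2(3)]) auto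
    finally show ?case by simp
  qed
qed

lemma finite_neighbours_distance_graph: "u \<in> V \<Longrightarrow> finite (neighbours (distance_graph k V E) u)"
  by (simp add: neighbours_distance_graph dist_sphere_finite_card)

lemma card_closed_walks_distance_graph_le:
  "u \<in> V \<Longrightarrow> card (closed_walks V (distance_graph k V E) u m) \<le> (d ^ k) ^ m"
  unfolding closed_walks_eq
  by (rule card_walks_into_le[OF finite_neighbours_distance_graph])
     (simp_all add: neighbours_distance_graph dist_sphere_finite_card Int_absorb2 dist_sphere_subset)

text \<open>Each step in the distance graph applies the distance-\<open>k\<close> operator to the
  number of ways to finish, which depends only on the distance to \<open>v\<close>.\<close>

lemma card_closed_walks_distance_graph:
  assumes v: "v \<in> V" and nc: "\<not> short_cycle_near V E (2 * (k * m) + 1) v"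
  shows "real (card (closed_walks V (distance_graph k V E) v m)) = tree_moment d k m"
proof -
  let ?D = "distance_graph k V E" and ?g = "\<lambda>m. (radial_sphere d k ^^ m) (\<lambda>i. of_bool (i = 0))"
  \<comment> \<open>Generalised to walks starting at distance \<open>i\<close> with \<open>l\<close>
    steps left. A step moves away by at most \<open>k\<close>, so \<open>i + k * l\<close> stays
    within the radius \<open>k * m\<close> for which short cycles are excluded.\<close>
  have "real (card (walks_into V ?D l u {v})) = ?g l i"
    if "graph_dist V E u v = enat i" "i + k * l \<le> k * m" for l u i
    using that
  proof (induction l arbitrary: u i)
    case 0
    have u: "u \<in> V" using graph_dist_mem[OF 0(1)] by simp
    have "u = v \<longleftrightarrow> i = 0" using 0(1) u graph_dist_0_iff[of V E u v] by (metis enat.inject)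
    thus ?case using u by (cases "i = 0") (simp_all add: walks_into_0)
  next
    case (Suc l)
    have u: "u \<in> V" using graph_dist_mem[OF Suc.prems(1)] by simp
    have "real (card (walks_into V ?D (Suc l) u {v})) =
        (\<Sum>x\<in>dist_sphere V E k u. real (card (walks_into V ?D l x {v})))"
      by (subst walks_into_finite_card(2)[OF finite_neighbours_distance_graph u])
         (simp_all add: neighbours_distance_graph[OF u] Int_absorb2 dist_sphere_subset)
    also have "\<dots> = radial_sphere d k (?g l) i"
      by (rule sum_sphere_radial[OF nc Suc.prems(1)]) (use Suc in \<open>auto simp: algebra_simps\<close>)
    finally show ?case by simp
  qed
  from this[of v 0 m] show ?thesis using v
    by (simp add: graph_dist_0_iff closed_walks_eq tree_moment_def)
qed

end

lemma acyclic_no_short_cycle: "acyclic_graph V E \<Longrightarrow> \<not> short_cycle_near V E L v"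
  by (auto simp: acyclic_graph_def short_cycle_near_def short_cycle_at_def graph_cycle_def)

section \<open>Switching\<close>

definition switch :: "'v set set \<Rightarrow> 'v \<Rightarrow> 'v \<Rightarrow> 'v \<Rightarrow> 'v \<Rightarrow> 'v set set" where
  "switch E x y a b = (E - {{x, y}, {a, b}}) \<union> {{x, a}, {y, b}}"

text \<open>Each of the four vertices loses one edge and gains one; distinctness and the two
  non-edges ensure that the gained edges are proper and new.\<close>

lemma regular_graph_switch:
  assumes E: "regular_graph d V E" and e: "{x, y} \<in> E" "{a, b} \<in> E" "{x, a} \<notin> E" "{y, b} \<notin> E"
    and dist: "distinct [x, y, a, b]"
  shows "regular_graph d V (switch E x y a b)"
proof -
  have reg: "\<And>w. w \<in> V \<Longrightarrow> finite {e\<in>E. w \<in> e} \<and> card {e\<in>E. w \<in> e} = d"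
    and simp: "\<And>e. e \<in> E \<Longrightarrow> e \<subseteq> V \<and> card e = 2"
    using E by (auto simp: regular_graph_def simple_graph_def)
  have V: "x \<in> V" "y \<in> V" "a \<in> V" "b \<in> V" using simp[OF e(1)] simp[OF e(2)] by auto
  have "simple_graph V (switch E x y a b)"
    using simp V dist by (auto simp: simple_graph_def switch_def)
  moreover have "finite {e \<in> switch E x y a b. w \<in> e} \<and> card {e \<in> switch E x y a b. w \<in> e} = d"
    if w: "w \<in> V" for w
  proof -
    have swap: "finite (insert f ({e\<in>E. w \<in> e} - {g})) \<and> card (insert f ({e\<in>E. w \<in> e} - {g})) = d"
      if "f \<notin> E" "g \<in> E" "w \<in> g" for f g
    proof -
      have "card (insert f ({e\<in>E. w \<in> e} - {g})) = Suc (card ({e\<in>E. w \<in> e} - {g}))"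
        using reg[OF w] that by (subst card_insert_disjoint) auto
      also have "\<dots> = card {e\<in>E. w \<in> e}"
        using reg[OF w] that by (intro card_Suc_Diff1) auto
      finally show ?thesis using reg[OF w] by simp
    qed
    \<comment> \<open>The cases \<open>x\<close>, \<open>y\<close>, \<open>a\<close>,
      \<open>b\<close> share one pattern: of the removed edges only \<open>P\<close> contains
      \<open>w\<close>, of the added ones only \<open>S\<close>.\<close>
    have exch: "finite {e \<in> (E - D) \<union> N. w \<in> e} \<and> card {e \<in> (E - D) \<union> N. w \<in> e} = d"
      if DN: "D = {P, Q}" "N = {R, S}" and w: "w \<in> P" "w \<notin> Q" "w \<notin> R" "w \<in> S"
        and E: "P \<in> E" "S \<notin> E"
      for D N P Q R S
    proof -
      have "{e \<in> (E - D) \<union> N. w \<in> e} = insert S ({e\<in>E. w \<in> e} - {P})"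
        using w unfolding DN by blast
      thus ?thesis using swap[OF E(2,1) w(1)] by (simp only:)
    qed
    consider "w = x" | "w = y" | "w = a" | "w = b" | "w \<notin> {x, y, a, b}" by auto
    thus ?thesis
    proof cases
      case 1
      show ?thesis unfolding switch_def
        by (rule exch[of _ "{x, y}" "{a, b}" _ "{y, b}" "{x, a}"]) (use dist e 1 in auto)
    next
      case 2
      show ?thesis unfolding switch_def
        by (rule exch[of _ "{x, y}" "{a, b}" _ "{x, a}" "{y, b}"]) (use dist e 2 in auto)
    next
      case 3
      show ?thesis unfolding switch_def
        by (rule exch[of _ "{a, b}" "{x, y}" _ "{y, b}" "{x, a}"]) (use dist e 3 in auto)
    next
      case 4
      show ?thesis unfolding switch_def
        by (rule exch[of _ "{a, b}" "{x, y}" _ "{x, a}" "{y, b}"]) (use dist e 4 in auto)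
    next
      case 5
      have "{e \<in> switch E x y a b. w \<in> e} = {e\<in>E. w \<in> e}" using 5 by (auto simp: switch_def)
      thus ?thesis using reg[OF w] by simp
    qed
  qed
  ultimately show ?thesis by (simp add: regular_graph_def)
qed

text \<open>Makes switching injective once the four vertices are remembered.\<close>

lemma switch_inverse:
  assumes "{x, y} \<in> E" "{a, b} \<in> E" "{x, a} \<notin> E" "{y, b} \<notin> E"
  shows "E = (switch E x y a b - {{x, a}, {y, b}}) \<union> {{x, y}, {a, b}}"
proof -
  have "E = ((E - {P, Q}) \<union> {R, S} - {R, S}) \<union> {P, Q}"
    if "P \<in> E" "Q \<in> E" "R \<notin> E" "S \<notin> E" for P Q R S using that by blast
  from this[OF assms] show ?thesis by (simp only: switch_def)
qed

text \<open>Only the closing edge and \<open>{a, b}\<close> are removed. The latter is no step of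
  the walk because \<open>a\<close> is not on it, and the former is none because a step joining the
  two ends would force \<open>length xs = 2\<close>.\<close>

lemma walk_switch:
  assumes c: "graph_cycle V E xs" and ab: "a \<notin> set xs"
  shows "walk V (switch E (hd xs) (last xs) a b) xs"
proof -
  have xs: "walk V E xs" "distinct xs" "length xs \<ge> 3" using c by (auto simp: graph_cycle_def)
  have "{xs ! i, xs ! Suc i} \<in> switch E (hd xs) (last xs) a b" if i: "Suc i < length xs" for i
  proof -
    have E: "{xs ! i, xs ! Suc i} \<in> E"
      using xs(1) i by (auto simp: walk_def successively_conv_nth)
    have ne: "xs \<noteq> []" using xs by auto
    have "{xs ! i, xs ! Suc i} \<noteq> {hd xs, last xs}"
    proof
      assume "{xs ! i, xs ! Suc i} = {hd xs, last xs}"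
      hence "(xs ! i = xs ! 0 \<and> xs ! Suc i = xs ! (length xs - 1)) \<or>
          (xs ! i = xs ! (length xs - 1) \<and> xs ! Suc i = xs ! 0)"
        using ne by (simp add: doubleton_eq_iff hd_conv_nth last_conv_nth)
      moreover have "xs ! i = xs ! 0 \<longleftrightarrow> i = 0" "xs ! Suc i \<noteq> xs ! 0"
        "xs ! Suc i = xs ! (length xs - 1) \<longleftrightarrow> Suc i = length xs - 1"
        using nth_eq_iff_index_eq[OF xs(2), of i 0] nth_eq_iff_index_eq[OF xs(2), of "Suc i" 0]
          nth_eq_iff_index_eq[OF xs(2), of "Suc i" "length xs - 1"] i ne by auto
      ultimately have "i = 0 \<and> Suc i = length xs - 1" by blast
      thus False using xs(3) by linarith
    qed
    moreover have "{xs ! i, xs ! Suc i} \<noteq> {a, b}"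
      using ab i nth_mem[of i xs] nth_mem[of "Suc i" xs] by (auto simp: doubleton_eq_iff)
    ultimately show ?thesis using E unfolding switch_def by blast
  qed
  thus ?thesis using xs by (simp add: walk_def successively_conv_nth)
qed

definition regular_graphs :: "nat \<Rightarrow> 'v set \<Rightarrow> 'v set set set" where
  "regular_graphs d V = {E. regular_graph d V E}"

definition short_cycles :: "'v set \<Rightarrow> nat \<Rightarrow> 'v set set \<Rightarrow> 'v list set" where
  "short_cycles V L E = {xs. graph_cycle V E xs \<and> length xs \<le> L}"

text \<open>The oriented edges that can be switched with the closing edge of \<open>xs\<close>; the
  conditions serve \<open>regular_graph_switch\<close> and \<open>walk_switch\<close>. Both
  orientations of an edge are separate choices.\<close>

definition switch_pairs :: "'v set set \<Rightarrow> 'v list \<Rightarrow> ('v \<times> 'v) set" where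
  "switch_pairs E xs = {(a, b). {a, b} \<in> E \<and> a \<notin> set xs \<and> b \<notin> set xs \<and>
     {hd xs, a} \<notin> E \<and> {last xs, b} \<notin> E}"

text \<open>Lengths below \<open>L\<close> mean at most \<open>L\<close> vertices, matching the
  bound in \<open>short_cycles\<close>.\<close>

definition bounded_walks :: "'v set \<Rightarrow> nat \<Rightarrow> 'v set set \<Rightarrow> 'v list set" where
  "bounded_walks V L E = (\<Union>m<L. \<Union>u\<in>V. walks_into V E m u UNIV)"

lemma finite_regular_graphs: "finite V \<Longrightarrow> finite (regular_graphs d V)"
  by (rule finite_subset[of _ "Pow (Pow V)"])
     (auto simp: regular_graphs_def regular_graph_def simple_graph_def)

section \<open>Counting walks, cycles and admissible edges\<close>

context regular
begin

lemma finite_card_bounded_walks: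
  assumes fin: "finite V"
  shows "finite (bounded_walks V L E) \<and> card (bounded_walks V L E) \<le> (\<Sum>m<L. card V * d ^ m)"
proof -
  have f: "finite (walks_into V E m u UNIV)" if "u \<in> V" for m u
    by (rule walks_into_finite_card(1)) (use that neighbours_finite_card in auto)
  have "card (bounded_walks V L E) \<le> (\<Sum>m<L. card (\<Union>u\<in>V. walks_into V E m u UNIV))"
    unfolding bounded_walks_def by (rule card_UN_le) simp
  also have "\<dots> \<le> (\<Sum>m<L. card V * d ^ m)"
  proof (rule sum_mono)
    fix m
    have "card (\<Union>u\<in>V. walks_into V E m u UNIV) \<le> (\<Sum>u\<in>V. card (walks_into V E m u UNIV))"
      by (rule card_UN_le[OF fin])
    also have "\<dots> \<le> (\<Sum>u\<in>V. d ^ m)" by (rule sum_mono) (rule card_walks_into_le_degree)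
    finally show "card (\<Union>u\<in>V. walks_into V E m u UNIV) \<le> card V * d ^ m" by simp
  qed
  finally show ?thesis using f fin by (auto simp: bounded_walks_def)
qed

lemma short_cycles_subset: "short_cycles V L E \<subseteq> bounded_walks V L E"
proof
  fix xs assume "xs \<in> short_cycles V L E"
  hence "walk V E xs" "length xs \<ge> 3" "length xs \<le> L" by (auto simp: short_cycles_def graph_cycle_def)
  hence "xs \<in> walks_into V E (length xs - 1) (hd xs) UNIV" "length xs - 1 < L" "hd xs \<in> V"
    by (auto simp: walks_into_def dest: walk_hd_last)
  thus "xs \<in> bounded_walks V L E" by (auto simp: bounded_walks_def)
qed

lemma finite_short_cycles: "finite V \<Longrightarrow> finite (short_cycles V L E)"
  using finite_subset[OF short_cycles_subset] finite_card_bounded_walks by blast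

text \<open>Of the \<open>d * card V\<close> oriented edges, an inadmissible one has its start on
  \<open>xs\<close> or adjacent to \<open>hd xs\<close>, or its end on \<open>xs\<close> or adjacent
  to \<open>last xs\<close>. Each alternative concerns at most \<open>L + d\<close> vertices, hence
  at most \<open>d * (L + d)\<close> oriented edges.\<close>

lemma card_switch_pairs:
  assumes fin: "finite V" and xs: "xs \<in> short_cycles V L E"
  shows "finite (switch_pairs E xs) \<and> d * card V \<le> card (switch_pairs E xs) + 2 * d * (L + d)"
proof -
  let ?A = "Sigma V (neighbours E)"
  have c: "hd xs \<in> V" "last xs \<in> V" "set xs \<subseteq> V" "length xs \<le> L"
    using xs by (auto simp: short_cycles_def graph_cycle_def walk_def)
  have bad: "finite (Sigma B (neighbours E)) \<and> card (Sigma B (neighbours E)) \<le> d * (L + d)"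
    if B: "B = set xs \<union> neighbours E u" and u: "u \<in> V" for B u
  proof -
    have "B \<subseteq> V" using B c neighbours_subset by auto
    have finB: "finite B" using B neighbours_finite_card[OF u] by simp
    have "card B \<le> card (set xs) + card (neighbours E u)" unfolding B by (rule card_Un_le)
    also have "\<dots> \<le> L + d" using neighbours_finite_card[OF u] card_length[of xs] c by simp
    finally have "card B \<le> L + d" .
    moreover have "card (Sigma B (neighbours E)) = (\<Sum>a\<in>B. d)"
    proof -
      have "card (Sigma B (neighbours E)) = (\<Sum>a\<in>B. card (neighbours E a))"
        using \<open>B \<subseteq> V\<close> finB neighbours_finite_card(1) by (intro card_SigmaI) auto
      also have "\<dots> = (\<Sum>a\<in>B. d)"
        using \<open>B \<subseteq> V\<close> neighbours_finite_card(2) by (intro sum.cong) auto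
      finally show ?thesis .
    qed
    moreover have "finite (Sigma B (neighbours E))"
      using finB \<open>B \<subseteq> V\<close> neighbours_finite_card(1) by (intro finite_SigmaI) auto
    ultimately show ?thesis by simp
  qed
  let ?B1 = "Sigma (set xs \<union> neighbours E (hd xs)) (neighbours E)"
  let ?B2 = "Sigma (set xs \<union> neighbours E (last xs)) (neighbours E)"
  have A: "finite ?A" "card ?A = d * card V"
    using fin neighbours_finite_card by (auto simp: card_SigmaI)
  have "?A \<subseteq> switch_pairs E xs \<union> ?B1 \<union> prod.swap ` ?B2"
  proof
    fix p assume "p \<in> ?A"
    then obtain a b where p: "p = (a, b)" "a \<in> V" "{a, b} \<in> E" by (auto simp: neighbours_def)
    hence "(a, b) \<in> switch_pairs E xs \<or> (a, b) \<in> ?B1 \<or> (b, a) \<in> ?B2"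
      by (auto simp: switch_pairs_def neighbours_def insert_commute)
    thus "p \<in> switch_pairs E xs \<union> ?B1 \<union> prod.swap ` ?B2" using p by force
  qed
  moreover have sub: "switch_pairs E xs \<subseteq> ?A"
    using edge by (auto simp: switch_pairs_def neighbours_def)
  moreover have fs: "finite (switch_pairs E xs)" using sub A(1) finite_subset by blast
  ultimately have "card ?A \<le> card (switch_pairs E xs \<union> ?B1 \<union> prod.swap ` ?B2)"
    using bad[OF refl c(1)] bad[OF refl c(2)] by (intro card_mono) auto
  also have "\<dots> \<le> card (switch_pairs E xs) + card ?B1 + card (prod.swap ` ?B2)"
    by (meson card_Un_le add_right_mono le_trans)
  also have "card (prod.swap ` ?B2) = card ?B2" by (rule card_image) simp
  finally show ?thesis using bad[OF refl c(1)] bad[OF refl c(2)] A fs by simp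
qed

text \<open>An affected vertex ends a walk of length at most \<open>L\<close> from the start of a
  short cycle, and at most \<open>d ^ m\<close> walks of length \<open>m\<close> start
  there.\<close>

lemma card_short_cycle_near_le:
  assumes fin: "finite V"
  shows "card {v\<in>V. short_cycle_near V E L v} \<le> card (short_cycles V L E) * (\<Sum>m\<le>L. d ^ m)"
proof -
  let ?W = "\<lambda>xs i. last ` walks_into V E i (hd xs) UNIV"
  have f: "finite (walks_into V E m u UNIV)" if "u \<in> V" for m u
    by (rule walks_into_finite_card(1)) (use that neighbours_finite_card in auto)
  have hd: "hd xs \<in> V" if "xs \<in> short_cycles V L E" for xs
    using that by (auto simp: short_cycles_def graph_cycle_def dest: walk_hd_last)
  have "{v\<in>V. short_cycle_near V E L v} \<subseteq> (\<Union>xs\<in>short_cycles V L E. \<Union>i\<le>L. ?W xs i)"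
    by (force simp: short_cycle_near_def short_cycle_at_def short_cycles_def walks_into_def)
  hence "card {v\<in>V. short_cycle_near V E L v} \<le> card (\<Union>xs\<in>short_cycles V L E. \<Union>i\<le>L. ?W xs i)"
    using f hd finite_short_cycles[OF fin] by (intro card_mono) auto
  also have "\<dots> \<le> (\<Sum>xs\<in>short_cycles V L E. card (\<Union>i\<le>L. ?W xs i))"
    by (rule card_UN_le[OF finite_short_cycles[OF fin]])
  also have "\<dots> \<le> (\<Sum>xs\<in>short_cycles V L E. \<Sum>m\<le>L. d ^ m)"
  proof (rule sum_mono)
    fix xs assume xs: "xs \<in> short_cycles V L E"
    have "card (\<Union>i\<le>L. ?W xs i) \<le> (\<Sum>i\<le>L. card (?W xs i))" by (rule card_UN_le) simp
    also have "\<dots> \<le> (\<Sum>m\<le>L. d ^ m)"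
      by (rule sum_mono)
         (meson card_image_le card_walks_into_le_degree f hd[OF xs] le_trans)
    finally show "card (\<Union>i\<le>L. ?W xs i) \<le> (\<Sum>m\<le>L. d ^ m)" .
  qed
  finally show ?thesis by simp
qed

end

text \<open>
  Replacing the closing edge of a short cycle and a far edge \<open>{a, b}\<close> by the two cross edges leaves a
  walk of bounded length with a marked neighbour at either end. There are roughly \<open>d\<close> times \<open>card V\<close>
  choices of \<open>(a, b)\<close>, but only linearly many such marked walks in a given graph.
\<close>

lemma switching_inequality:
  fixes V :: "'v set"
  assumes fin: "finite V"
  shows "(\<Sum>E\<in>regular_graphs d V. \<Sum>xs\<in>short_cycles V L E. card (switch_pairs E xs)) \<le>
         card (regular_graphs d V) * (card V * (\<Sum>m<L. d ^ m) * d\<^sup>2)"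
proof -
  let ?G = "regular_graphs d V"
  \<comment> \<open>The left-hand sum is the size of \<open>?S\<close>. The map \<open>?f\<close>
    switches but keeps \<open>xs\<close>, \<open>a\<close> and \<open>b\<close>, which makes it
    injective; in \<open>?T\<close> the vertices \<open>a\<close> and \<open>b\<close> are
    neighbours of the two ends, whence the factor \<open>d\<^sup>2\<close>.\<close>
  let ?S = "SIGMA E:?G. SIGMA xs:short_cycles V L E. switch_pairs E xs"
  let ?T = "SIGMA E:?G. SIGMA xs:bounded_walks V L E. neighbours E (hd xs) \<times> neighbours E (last xs)"
  let ?f = "\<lambda>(E, xs, a, b). (switch E (hd xs) (last xs) a b, xs, a, b)"
  have reg: "regular d V E" if "E \<in> ?G" for E using that by (simp add: regular_graphs_def regular_def)
  note finG = finite_regular_graphs[OF fin, of d]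
  have e: "{hd xs, last xs} \<in> E" "{a, b} \<in> E" "{hd xs, a} \<notin> E" "{last xs, b} \<notin> E"
      "distinct [hd xs, last xs, a, b]" "walk V E xs" "a \<notin> set xs" "length xs \<le> L"
      "graph_cycle V E xs" "length xs \<ge> 3"
    if "E \<in> ?G" "xs \<in> short_cycles V L E" "(a, b) \<in> switch_pairs E xs" for E xs a b
  proof -
    have c: "walk V E xs" "distinct xs" "length xs \<ge> 3" "{last xs, hd xs} \<in> E" "length xs \<le> L"
      "graph_cycle V E xs"
      using that by (auto simp: short_cycles_def graph_cycle_def)
    have ab: "{a, b} \<in> E" "a \<notin> set xs" "b \<notin> set xs" "{hd xs, a} \<notin> E" "{last xs, b} \<notin> E"
      using that by (auto simp: switch_pairs_def)
    have ne: "xs \<noteq> []" using c by auto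
    show "{hd xs, last xs} \<in> E" using c by (simp add: insert_commute)
    have "hd xs \<noteq> last xs" using regular.edge[OF reg[OF that(1)] c(4)] by auto
    moreover have "a \<noteq> b" using regular.edge[OF reg[OF that(1)] ab(1)] by auto
    moreover have "hd xs \<in> set xs" "last xs \<in> set xs" using ne by auto
    ultimately show "distinct [hd xs, last xs, a, b]" using ab by auto
    show "{a, b} \<in> E" "{hd xs, a} \<notin> E" "{last xs, b} \<notin> E" "walk V E xs" "a \<notin> set xs"
      "length xs \<le> L" "graph_cycle V E xs" "length xs \<ge> 3" using c ab by auto
  qed
  have inj: "inj_on ?f ?S"
  proof (rule inj_onI)
    fix s t assume st: "s \<in> ?S" "t \<in> ?S" "?f s = ?f t"
    obtain E xs a b where s: "s = (E, xs, a, b)" by (metis prod_cases4)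
    obtain E' where t: "t = (E', xs, a, b)" using st(3) s by (cases t) auto
    have eq: "switch E (hd xs) (last xs) a b = switch E' (hd xs) (last xs) a b"
      using st(3) s t by simp
    have A: "E \<in> ?G" "xs \<in> short_cycles V L E" "(a, b) \<in> switch_pairs E xs"
      "E' \<in> ?G" "xs \<in> short_cycles V L E'" "(a, b) \<in> switch_pairs E' xs"
      using st(1,2) s t by auto
    have "E = E'"
      using switch_inverse[OF e(1-4)[OF A(1-3)]] switch_inverse[OF e(1-4)[OF A(4-6)]] eq by simp
    thus "s = t" using s t by simp
  qed
  have img: "?f ` ?S \<subseteq> ?T"
  proof
    fix t assume "t \<in> ?f ` ?S"
    then obtain E xs a b where t: "t = (switch E (hd xs) (last xs) a b, xs, a, b)" and A: "E \<in> ?G" "xs \<in> short_cycles V L E" "(a, b) \<in> switch_pairs E xs"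
      by auto
    note e = e[OF A]
    let ?E = "switch E (hd xs) (last xs) a b"
    have "?E \<in> ?G"
      using regular_graph_switch[OF _ e(1-5)] A(1) by (simp add: regular_graphs_def)
    moreover have "walk V ?E xs" by (rule walk_switch[OF e(9,7)])
    hence "xs \<in> walks_into V ?E (length xs - 1) (hd xs) UNIV" "length xs - 1 < L" "hd xs \<in> V"
      using e(8,10) by (auto simp: walks_into_def dest: walk_hd_last)
    hence "xs \<in> bounded_walks V L ?E" by (auto simp: bounded_walks_def)
    moreover have "a \<in> neighbours ?E (hd xs)" "b \<in> neighbours ?E (last xs)"
      by (auto simp: neighbours_def switch_def)
    ultimately show "t \<in> ?T" unfolding t by blast
  qed
  have inner: "finite (SIGMA xs:bounded_walks V L E. neighbours E (hd xs) \<times> neighbours E (last xs)) \<and>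
      card (SIGMA xs:bounded_walks V L E. neighbours E (hd xs) \<times> neighbours E (last xs)) \<le>
        card V * (\<Sum>m<L. d ^ m) * d\<^sup>2" if E: "E \<in> ?G" for E
  proof -
    interpret regular d V E by (rule reg[OF E])
    note fw = finite_card_bounded_walks[OF fin, of L]
    have nb: "finite (neighbours E (hd xs)) \<and> card (neighbours E (hd xs)) = d \<and>
        finite (neighbours E (last xs)) \<and> card (neighbours E (last xs)) = d"
      if "xs \<in> bounded_walks V L E" for xs
    proof -
      have "hd xs \<in> V \<and> last xs \<in> V"
        using that walk_hd_last by (auto simp: bounded_walks_def walks_into_def)
      thus ?thesis using neighbours_finite_card by auto
    qed
    have "card (SIGMA xs:bounded_walks V L E. neighbours E (hd xs) \<times> neighbours E (last xs)) =
        (\<Sum>xs\<in>bounded_walks V L E. d * d)"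
      using fw nb by (subst card_SigmaI) (auto simp: card_cartesian_product intro!: sum.cong)
    also have "\<dots> \<le> card V * (\<Sum>m<L. d ^ m) * d\<^sup>2"
      using fw by (simp add: power2_eq_square sum_distrib_left)
    finally show ?thesis using fw nb by auto
  qed
  have fP: "finite (switch_pairs E xs)" if "E \<in> ?G" "xs \<in> short_cycles V L E" for E xs
    using regular.card_switch_pairs[OF reg[OF that(1)] fin that(2)] by blast
  have fC: "finite (short_cycles V L E)" if "E \<in> ?G" for E
    using regular.finite_short_cycles[OF reg[OF that] fin] .
  have "(\<Sum>E\<in>?G. \<Sum>xs\<in>short_cycles V L E. card (switch_pairs E xs)) = card ?S"
    using finG fP fC by (subst card_SigmaI) (auto intro!: sum.cong card_SigmaI[symmetric])
  also have "\<dots> = card (?f ` ?S)" using card_image[OF inj] by simp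
  also have "\<dots> \<le> card ?T" using finG inner by (intro card_mono[OF _ img]) auto
  also have "\<dots> = (\<Sum>E\<in>?G. card (SIGMA xs:bounded_walks V L E. neighbours E (hd xs) \<times> neighbours E (last xs)))"
    using finG inner by (intro card_SigmaI) auto
  also have "\<dots> \<le> (\<Sum>E\<in>?G. card V * (\<Sum>m<L. d ^ m) * d\<^sup>2)"
    using inner by (intro sum_mono) auto
  finally show ?thesis by simp
qed

text \<open>The bound on \<open>card V\<close> makes at least half of the \<open>d * card V\<close>
  oriented edges admissible for each short cycle. Hence \<open>switching_inequality\<close>, divided
  by \<open>d * card V\<close>, bounds the average number of short cycles independently of
  \<open>V\<close>, and each affects boundedly many vertices.\<close>

lemma sum_card_short_cycle_near_le:
  fixes V :: "'v set"
  assumes fin: "finite V" and d: "d \<ge> 1" and N: "card V \<ge> 4 * (L + d)"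
  shows "(\<Sum>E\<in>regular_graphs d V. card {v\<in>V. short_cycle_near V E L v}) \<le>
         card (regular_graphs d V) * (2 * d * (\<Sum>m\<le>L. d ^ m)\<^sup>2)"
proof -
  let ?G = "regular_graphs d V" and ?N = "card V" and ?S = "\<Sum>m\<le>L. d ^ m"
  let ?X = "\<Sum>E\<in>?G. card (short_cycles V L E)"
  have reg: "regular d V E" if "E \<in> ?G" for E using that by (simp add: regular_graphs_def regular_def)
  have half: "d * ?N \<le> 2 * card (switch_pairs E xs)" if "E \<in> ?G" "xs \<in> short_cycles V L E" for E xs
  proof -
    have "d * (4 * (L + d)) \<le> d * ?N" using N by (rule mult_left_mono) simp
    thus ?thesis using regular.card_switch_pairs[OF reg[OF that(1)] fin that(2)]
      by (simp add: algebra_simps)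
  qed
  have pos: "?N > 0" using N d by simp
  have "(d * ?N) * ?X = (\<Sum>E\<in>?G. \<Sum>xs\<in>short_cycles V L E. d * ?N)"
    by (simp add: sum_distrib_left mult.commute)
  also have "\<dots> \<le> (\<Sum>E\<in>?G. \<Sum>xs\<in>short_cycles V L E. 2 * card (switch_pairs E xs))"
    by (intro sum_mono half)
  also have "\<dots> = 2 * (\<Sum>E\<in>?G. \<Sum>xs\<in>short_cycles V L E. card (switch_pairs E xs))"
    by (simp add: sum_distrib_left)
  also have "\<dots> \<le> 2 * (card ?G * (?N * (\<Sum>m<L. d ^ m) * d\<^sup>2))"
    using switching_inequality[OF fin, of L d] by simp
  also have "\<dots> \<le> 2 * (card ?G * (?N * ?S * d\<^sup>2))"
    by (intro mult_left_mono mult_right_mono sum_mono2) auto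
  also have "\<dots> = (d * ?N) * (card ?G * (2 * d * ?S))" by (simp add: power2_eq_square)
  finally have X: "?X \<le> card ?G * (2 * d * ?S)" using pos d by (simp only: mult_le_cancel1) simp
  have "(\<Sum>E\<in>?G. card {v\<in>V. short_cycle_near V E L v}) \<le> (\<Sum>E\<in>?G. card (short_cycles V L E) * ?S)"
    by (intro sum_mono regular.card_short_cycle_near_le[OF reg fin])
  also have "\<dots> = ?X * ?S" by (simp add: sum_distrib_right)
  also have "\<dots> \<le> card ?G * (2 * d * ?S) * ?S" using X by (rule mult_right_mono) simp
  finally show ?thesis by (simp add: power2_eq_square mult_ac)
qed

section \<open>Existence of regular graphs\<close>

lemma card_filter_less_of_inj:
  assumes "inj_on f {..<n}" "f ` {..<n} \<subseteq> {..<n}" "d \<le> (n::nat)"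
  shows "card {t. t < n \<and> f t < d} = d"
proof -
  \<comment> \<open>An injection of a finite set into itself is onto, so each value below
    \<open>d\<close> is attained exactly once.\<close>
  have "f ` {..<n} = {..<n}" using assms by (intro endo_inj_surj) auto
  hence "{..<d} \<subseteq> f ` {..<n}" using assms(3) by auto
  hence "f ` {t. t < n \<and> f t < d} = {..<d}" by auto
  moreover have "inj_on f {t. t < n \<and> f t < d}" using assms(1) by (rule inj_on_subset) auto
  ultimately show ?thesis using card_image[of f "{t. t < n \<and> f t < d}"] by simp
qed

lemma regular_graphs_nonempty:
  assumes "d \<le> n"
  shows "regular_graphs d {1..2 * n} \<noteq> {}"
proof -
  \<comment> \<open>\<open>f i t\<close> is \<open>t - i\<close> modulo \<open>n\<close>, so \<open>E\<close> is a bipartite circulant graph.\<close>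
  define f where "f i t = (if i \<le> t then t - i else t + n - i)" for i t :: nat
  define E where "E = {{i + 1, n + 1 + t} | i t. i < n \<and> t < n \<and> f i t < d}"
  \<comment> \<open>For fixed \<open>i\<close>, and likewise for fixed \<open>t\<close>,
    \<open>f\<close> permutes the residues; the two counts are the degrees on the two sides.\<close>
  have row: "card {t. t < n \<and> f i t < d} = d" if "i < n" for i
    by (rule card_filter_less_of_inj) (use that assms in \<open>auto simp: f_def inj_on_def split: if_splits\<close>)
  have col: "card {i. i < n \<and> f i t < d} = d" if "t < n" for t
    by (rule card_filter_less_of_inj) (use that assms in \<open>auto simp: f_def inj_on_def split: if_splits\<close>)
  have "simple_graph {1..2 * n} E" by (auto simp: simple_graph_def E_def)
  moreover have "finite {e\<in>E. v \<in> e} \<and> card {e\<in>E. v \<in> e} = d" if v: "v \<in> {1..2 * n}" for v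
  proof (cases "v \<le> n")
    case True
    then obtain i where i: "v = i + 1" "i < n" using v that[of "v - 1"] by auto
    have eq: "{e\<in>E. v \<in> e} = (\<lambda>t. {i + 1, n + 1 + t}) ` {t. t < n \<and> f i t < d}"
      using i by (auto simp: E_def)
    have "inj_on (\<lambda>t. {i + 1, n + 1 + t}) {t. t < n \<and> f i t < d}"
      by (rule inj_onI) (auto simp: doubleton_eq_iff)
    thus ?thesis unfolding eq using row[OF i(2)] by (simp add: card_image)
  next
    case False
    then obtain t where t: "v = n + 1 + t" "t < n" using v that[of "v - n - 1"] by auto
    have eq: "{e\<in>E. v \<in> e} = (\<lambda>i. {i + 1, n + 1 + t}) ` {i. i < n \<and> f i t < d}"
      using t by (auto simp: E_def)
    have "inj_on (\<lambda>i. {i + 1, n + 1 + t}) {i. i < n \<and> f i t < d}"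
      by (rule inj_onI) (auto simp: doubleton_eq_iff)
    thus ?thesis unfolding eq using col[OF t(2)] by (simp add: card_image)
  qed
  ultimately have "E \<in> regular_graphs d {1..2 * n}" by (simp add: regular_graphs_def regular_graph_def)
  thus ?thesis by blast
qed

section \<open>Eigenvalues and closed walks\<close>

text \<open>The quadratic form \<open>q\<close> at an eigenvector equals \<open>a\<close> times the
  squared norm \<open>s\<close>. By symmetry \<open>q\<close> is its own conjugate, and
  \<open>s > 0\<close>, so \<open>a\<close> is a quotient of reals.\<close>

lemma symmetric_eigenvalue_real:
  fixes A :: "real mat"
  assumes A: "A \<in> carrier_mat n n"
    and sym: "\<And>i j. i < n \<Longrightarrow> j < n \<Longrightarrow> A $$ (i, j) = A $$ (j, i)"
    and ev: "eigenvalue (map_mat complex_of_real A) a"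
  shows "a \<in> \<real>"
proof -
  let ?C = "map_mat complex_of_real A"
  have C: "?C \<in> carrier_mat n n" using A by auto
  obtain v where v: "v \<in> carrier_vec n" "v \<noteq> 0\<^sub>v n" and Cv: "?C *\<^sub>v v = a \<cdot>\<^sub>v v"
    using ev A unfolding eigenvalue_def eigenvector_def by auto
  have row: "(\<Sum>j<n. of_real (A $$ (i, j)) * v $ j) = a * v $ i" if "i < n" for i
  proof -
    have "(?C *\<^sub>v v) $ i = (\<Sum>j<n. of_real (A $$ (i, j)) * v $ j)"
      using A v that by (auto simp: scalar_prod_def atLeast0LessThan intro!: sum.cong)
    thus ?thesis unfolding Cv using v that by simp
  qed
  define q where "q = (\<Sum>i<n. cnj (v $ i) * (\<Sum>j<n. of_real (A $$ (i, j)) * v $ j))"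
  define s where "s = (\<Sum>i<n. (cmod (v $ i))\<^sup>2)"
  have q: "q = a * of_real s"
    unfolding q_def s_def of_real_sum sum_distrib_left[of a]
    by (rule sum.cong) (simp_all add: row complex_norm_square del: of_real_power)
  have "cnj q = (\<Sum>i<n. \<Sum>j<n. v $ i * of_real (A $$ (i, j)) * cnj (v $ j))"
    unfolding q_def by (simp add: sum_distrib_left mult_ac)
  also have "\<dots> = (\<Sum>j<n. \<Sum>i<n. v $ i * of_real (A $$ (i, j)) * cnj (v $ j))"
    by (rule sum.swap)
  also have "\<dots> = q"
    unfolding q_def sum_distrib_left
    by (intro sum.cong refl) (simp add: sym mult_ac)
  finally have "q \<in> \<real>" by (simp add: Reals_cnj_iff)
  obtain i where i: "i < n" "v $ i \<noteq> 0" using v by (metis carrier_vecD eq_vecI index_zero_vec)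
  have "s > 0" unfolding s_def
    by (rule sum_pos2[where i = i]) (use i in auto)
  hence "a = q / of_real s" using q by simp
  thus ?thesis using \<open>q \<in> \<real>\<close> by (auto intro: Reals_divide)
qed

text \<open>The polynomial splits over the complex numbers with real roots, and the factorisation
  descends because the embedding of real polynomials is injective.\<close>

lemma symmetric_char_poly_splits:
  fixes A :: "real mat"
  assumes A: "A \<in> carrier_mat n n"
    and sym: "\<And>i j. i < n \<Longrightarrow> j < n \<Longrightarrow> A $$ (i, j) = A $$ (j, i)"
  shows "\<exists>es. char_poly A = (\<Prod>e\<leftarrow>es. [:- e, 1:]) \<and> length es = n"
proof -
  interpret H: map_poly_inj_comm_ring_hom complex_of_real ..
  let ?C = "map_mat complex_of_real A"
  have C: "?C \<in> carrier_mat n n" using A by auto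
  from char_poly_factorized[OF C] obtain as where
    as: "char_poly ?C = (\<Prod>a\<leftarrow>as. [:- a, 1:])" "length as = n" by auto
  have "a \<in> \<real>" if "a \<in> set as" for a
  proof -
    have "poly (char_poly ?C) a = 0" unfolding as using that
      by (auto simp: poly_prod_list prod_list_zero_iff)
    thus ?thesis
      using symmetric_eigenvalue_real[OF A sym] eigenvalue_root_char_poly[OF C] by blast
  qed
  hence re: "map (complex_of_real \<circ> Re) as = as"
    by (intro map_idI) (auto simp: of_real_Re)
  have "map_poly complex_of_real (char_poly A) = (\<Prod>a\<leftarrow>as. [:- a, 1:])"
    using as of_real_hom.char_poly_hom[OF A, where 'a = complex] by simp
  also have "\<dots> = map_poly complex_of_real (\<Prod>e\<leftarrow>map Re as. [:- e, 1:])"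
    by (subst re[symmetric]) (simp add: H.hom_prod_list o_def)
  finally have "char_poly A = (\<Prod>e\<leftarrow>map Re as. [:- e, 1:])"
    using H.injectivity by blast
  thus ?thesis using as(2) by (metis length_map)
qed

section \<open>Traces of powers\<close>

lemma sum_diag_similar:
  fixes A :: "'a :: comm_ring_1 mat"
  assumes A: "A \<in> carrier_mat n n" and sim: "similar_mat_wit A B P Q"
  shows "(\<Sum>i<n. A $$ (i, i)) = (\<Sum>i<n. B $$ (i, i))"
proof -
  note w = similar_mat_witD2[OF A sim]
  have PB: "P * B \<in> carrier_mat n n" using w by auto
  have prod: "(X * Y) $$ (i, i) = (\<Sum>j<n. X $$ (i, j) * Y $$ (j, i))"
    if "X \<in> carrier_mat n n" "Y \<in> carrier_mat n n" "i < n" for X Y :: "'a mat" and i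
    using that by (auto simp: scalar_prod_def atLeast0LessThan intro!: sum.cong)
  have "(\<Sum>i<n. A $$ (i, i)) = (\<Sum>i<n. \<Sum>j<n. (P * B) $$ (i, j) * Q $$ (j, i))"
    unfolding w(3) by (intro sum.cong refl prod PB w(7)) simp
  \<comment> \<open>Cyclicity of the trace: exchanging the summations turns \<open>P * B * Q\<close>
    into \<open>Q * (P * B)\<close>.\<close>
  also have "\<dots> = (\<Sum>j<n. \<Sum>i<n. Q $$ (j, i) * (P * B) $$ (i, j))"
    by (subst sum.swap) (simp add: mult.commute)
  also have "\<dots> = (\<Sum>j<n. (Q * (P * B)) $$ (j, j))"
    by (intro sum.cong refl prod[symmetric] PB w(7)) simp
  also have "Q * (P * B) = B"
    using assoc_mult_mat[OF w(7,6,5)] w(2) left_mult_one_mat[OF w(5)] by simp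
  finally show ?thesis .
qed

lemma upper_triangular_pow:
  fixes B :: "'a :: comm_ring_1 mat"
  assumes B: "B \<in> carrier_mat n n" and ut: "upper_triangular B"
  shows "upper_triangular (B ^\<^sub>m m) \<and> (\<forall>i<n. (B ^\<^sub>m m) $$ (i, i) = (B $$ (i, i)) ^ m)"
proof (induction m)
  case 0
  show ?case using B by simp
next
  case (Suc m)
  let ?M = "B ^\<^sub>m m"
  have M: "?M \<in> carrier_mat n n" using B by simp
  have ent: "(B ^\<^sub>m Suc m) $$ (i, j) = (\<Sum>l<n. ?M $$ (i, l) * B $$ (l, j))"
    if "i < n" "j < n" for i j
    using that M B by (auto simp: scalar_prod_def atLeast0LessThan intro!: sum.cong)
  have z: "?M $$ (i, l) * B $$ (l, j) = 0" if "i < n" "l < n" "l < i \<or> j < l" for i j l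
    using that Suc B M upper_triangularD[OF ut, of j l] upper_triangularD[of ?M l i] by auto
  show ?case
  proof (intro conjI upper_triangularI allI impI)
    fix i j assume ij: "j < i" "i < dim_row (B ^\<^sub>m Suc m)"
    hence "i < n" using B by simp
    show "(B ^\<^sub>m Suc m) $$ (i, j) = 0"
      unfolding ent[OF \<open>i < n\<close> less_trans[OF ij(1) \<open>i < n\<close>]]
    proof (rule sum.neutral, intro ballI)
      fix l assume "l \<in> {..<n}"
      thus "?M $$ (i, l) * B $$ (l, j) = 0" using z[OF \<open>i < n\<close>, of l j] ij by force
    qed
  next
    fix i assume i: "i < n"
    have "(\<Sum>l<n. ?M $$ (i, l) * B $$ (l, i)) = (\<Sum>l\<in>{i}. ?M $$ (i, l) * B $$ (l, i))"
      by (rule sum.mono_neutral_right) (use i z[OF i] in \<open>auto simp: linorder_neq_iff\<close>)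
    thus "(B ^\<^sub>m Suc m) $$ (i, i) = (B $$ (i, i)) ^ Suc m"
      using ent[OF i i] Suc i by simp
  qed
qed

text \<open>Similarity preserves the trace of every power, and the Schur form is triangular with the
  list \<open>es\<close> on its diagonal.\<close>

lemma sum_diag_pow_eq_sum_eigenvalues:
  fixes A :: "real mat"
  assumes A: "A \<in> carrier_mat n n" and cp: "char_poly A = (\<Prod>e\<leftarrow>es. [:- e, 1:])"
  shows "(\<Sum>i<n. (A ^\<^sub>m m) $$ (i, i)) = (\<Sum>e\<leftarrow>es. e ^ m)"
proof -
  obtain B P Q where s: "schur_decomposition A es = (B, P, Q)" by (metis prod_cases3)
  note sd = schur_decomposition[OF A cp s]
  have sim: "similar_mat_wit A B P Q" using sd by simp
  have B: "B \<in> carrier_mat n n" using similar_mat_witD2[OF A sim] by simp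
  have "(\<Sum>i<n. (A ^\<^sub>m m) $$ (i, i)) = (\<Sum>i<n. (B ^\<^sub>m m) $$ (i, i))"
    by (rule sum_diag_similar[OF _ similar_mat_wit_pow[OF sim]]) (use A in simp)
  also have "\<dots> = (\<Sum>i<n. (B $$ (i, i)) ^ m)"
    using upper_triangular_pow[OF B, of m] sd by (intro sum.cong) auto
  also have "\<dots> = (\<Sum>e\<leftarrow>diag_mat B. e ^ m)"
    using B by (simp add: diag_mat_def o_def interv_sum_list_conv_sum_set_nat atLeast0LessThan)
  finally show ?thesis using sd by simp
qed

lemma proots_linear_factors: "proots (\<Prod>e\<leftarrow>es. [:- e, 1:]) = mset (es :: 'a :: idom list)"
proof (induction es)
  case (Cons e es)
  have "proots ([:- e, 1:] * (\<Prod>e\<leftarrow>es. [:- e, 1:])) =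
      proots [:- e, 1:] + proots (\<Prod>e\<leftarrow>es. [:- e, 1:])"
    by (rule proots_mult) (auto simp: prod_list_zero_iff)
  thus ?case using Cons by (simp only: list.map prod_list.Cons proots_linear_factor) simp
qed simp

text \<open>Matrix powers unfold on the right, whereas walks are split at their first step; this
  aligns the two recursions.\<close>

lemma pow_mat_Suc_left:
  fixes A :: "'a :: semiring_1 mat"
  assumes A: "A \<in> carrier_mat n n"
  shows "A ^\<^sub>m Suc m = A * A ^\<^sub>m m"
proof (induction m)
  case (Suc m)
  have "A ^\<^sub>m Suc (Suc m) = A * A ^\<^sub>m m * A" using Suc by simp
  also have "\<dots> = A * (A ^\<^sub>m m * A)" using A by (intro assoc_mult_mat[of _ n n _ n _ n]) auto
  finally show ?case by simp
qed (use A in simp)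

section \<open>Moments of the eigenvalue distribution as closed-walk counts\<close>

lemma adjacency_matrix_carrier: "adjacency_matrix N E \<in> carrier_mat N N"
  by (simp add: adjacency_matrix_def)

lemma adjacency_matrix_pow:
  assumes fin: "\<And>u. u \<in> {1..N} \<Longrightarrow> finite (neighbours E u)" and ij: "i < N" "j < N"
  shows "(adjacency_matrix N E ^\<^sub>m m) $$ (i, j) = real (card (walks_into {1..N} E m (i + 1) {j + 1}))"
  using ij(1)
proof (induction m arbitrary: i)
  case 0
  thus ?case using ij(2) by (simp add: adjacency_matrix_def walks_into_0)
next
  case (Suc m)
  let ?A = "adjacency_matrix N E"
  let ?h = "\<lambda>x. real (card (walks_into {1..N} E m x {j + 1}))"
  have A: "?A \<in> carrier_mat N N" by (rule adjacency_matrix_carrier)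
  hence "?A ^\<^sub>m m \<in> carrier_mat N N" by simp
  hence "(?A ^\<^sub>m Suc m) $$ (i, j) = (\<Sum>l<N. ?A $$ (i, l) * (?A ^\<^sub>m m) $$ (l, j))"
    unfolding pow_mat_Suc_left[OF A] using A Suc.prems ij(2)
    by (auto simp: scalar_prod_def atLeast0LessThan intro!: sum.cong)
  also have "\<dots> = (\<Sum>l<N. of_bool (Suc l \<in> neighbours E (i + 1)) * ?h (Suc l))"
    by (rule sum.cong[OF refl])
       (use Suc in \<open>simp add: adjacency_matrix_def neighbours_def\<close>)
  also have "\<dots> = (\<Sum>x\<in>{1..N}. of_bool (x \<in> neighbours E (i + 1)) * ?h x)"
    by (rule sum.reindex_bij_witness[of _ "\<lambda>x. x - 1" Suc]) auto
  also have "\<dots> = (\<Sum>x\<in>neighbours E (i + 1) \<inter> {1..N}. ?h x)"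
    by (rule sum.mono_neutral_cong_right) auto
  also have "\<dots> = real (card (walks_into {1..N} E (Suc m) (i + 1) {j + 1}))"
    by (subst walks_into_finite_card(2)[OF fin]) (use Suc.prems in auto)
  finally show ?case .
qed

lemma sum_count_mset:
  fixes f :: "'a \<Rightarrow> real"
  assumes "finite X" "set xs \<subseteq> X"
  shows "(\<Sum>x\<in>X. real (count (mset xs) x) * f x) = (\<Sum>x\<leftarrow>xs. f x)"
  using assms(2)
proof (induction xs)
  case (Cons a xs)
  have "(\<Sum>x\<in>X. real (count (mset (a # xs)) x) * f x) =
      (\<Sum>x\<in>X. real (count (mset xs) x) * f x + (if x = a then f a else 0))"
    by (rule sum.cong) (auto simp: algebra_simps)
  thus ?case using Cons assms(1) by (simp add: sum.distrib)
qed simp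

lemma expectation_pmf_of_list:
  fixes f :: "'a \<Rightarrow> real"
  assumes "xs \<noteq> []"
  shows "measure_pmf.expectation (pmf_of_multiset (mset xs)) f = (\<Sum>x\<leftarrow>xs. f x) / length xs"
proof -
  have "measure_pmf.expectation (pmf_of_multiset (mset xs)) f =
      (\<Sum>x\<in>set xs. f x * (count (mset xs) x / length xs))"
    using assms by (subst integral_measure_pmf_real[where A = "set xs"]) auto
  also have "\<dots> = (\<Sum>x\<in>set xs. real (count (mset xs) x) * f x) / length xs"
    by (simp add: sum_divide_distrib mult.commute)
  also have "(\<Sum>x\<in>set xs. real (count (mset xs) x) * f x) = (\<Sum>x\<leftarrow>xs. f x)"
    by (rule sum_count_mset) auto
  finally show ?thesis .
qed

text \<open>The power sums of the eigenvalues are traces and so count closed walks. For the bound,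
  an even power of one eigenvalue is at most the whole power sum, hence at most
  \<open>N * D ^ (2 * m)\<close>; for \<open>\<bar>x\<bar> > D\<close> this fails for large
  \<open>m\<close>.\<close>

lemma eigenvalue_distribution_moments:
  assumes N: "N > 0" and fin: "\<And>u. u \<in> {1..N} \<Longrightarrow> finite (neighbours E u)"
  shows "finite (set_pmf (eigenvalue_distribution N E))"
    and "measure_pmf.expectation (eigenvalue_distribution N E) (\<lambda>x. x ^ m) =
      (\<Sum>v\<in>{1..N}. real (card (closed_walks {1..N} E v m))) / N"
    and "(\<And>v m. v \<in> {1..N} \<Longrightarrow> card (closed_walks {1..N} E v m) \<le> D ^ m) \<Longrightarrow> D > 0 \<Longrightarrow>
      x \<in> set_pmf (eigenvalue_distribution N E) \<Longrightarrow> \<bar>x\<bar> \<le> real D"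
proof -
  let ?A = "adjacency_matrix N E"
  have A: "?A \<in> carrier_mat N N" by (rule adjacency_matrix_carrier)
  have "?A $$ (i, j) = ?A $$ (j, i)" if "i < N" "j < N" for i j
    using that by (simp add: adjacency_matrix_def insert_commute)
  from symmetric_char_poly_splits[OF A this] obtain es where
    es: "char_poly ?A = (\<Prod>e\<leftarrow>es. [:- e, 1:])" "length es = N" by blast
  have ne: "es \<noteq> []" using es N by auto
  have ed: "eigenvalue_distribution N E = pmf_of_multiset (mset es)"
    by (simp add: eigenvalue_distribution_def es proots_linear_factors)
  show "finite (set_pmf (eigenvalue_distribution N E))" using ne by (simp add: ed)
  have pow: "(\<Sum>e\<leftarrow>es. e ^ m) = (\<Sum>v\<in>{1..N}. real (card (closed_walks {1..N} E v m)))" for m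
  proof -
    have "(\<Sum>e\<leftarrow>es. e ^ m) = (\<Sum>i<N. real (card (walks_into {1..N} E m (i + 1) {i + 1})))"
      unfolding sum_diag_pow_eq_sum_eigenvalues[OF A es(1), symmetric]
      by (intro sum.cong refl adjacency_matrix_pow fin) auto
    also have "\<dots> = (\<Sum>v\<in>{1..N}. real (card (closed_walks {1..N} E v m)))"
      unfolding closed_walks_eq
      by (rule sum.reindex_bij_witness[of _ "\<lambda>x. x - 1" Suc]) auto
    finally show ?thesis .
  qed
  show "measure_pmf.expectation (eigenvalue_distribution N E) (\<lambda>x. x ^ m) =
      (\<Sum>v\<in>{1..N}. real (card (closed_walks {1..N} E v m))) / N"
    unfolding ed expectation_pmf_of_list[OF ne] pow es(2) ..
  assume D: "\<And>v m. v \<in> {1..N} \<Longrightarrow> card (closed_walks {1..N} E v m) \<le> D ^ m" "D > 0"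
    and x: "x \<in> set_pmf (eigenvalue_distribution N E)"
  have xs: "x \<in> set es" using x ne by (simp add: ed)
  have le: "(\<bar>x\<bar> / D) ^ (2 * m) \<le> N" for m
  proof -
    have "\<bar>x\<bar> ^ (2 * m) = x ^ (2 * m)" by (simp add: power_mult)
    also have "\<dots> \<le> (\<Sum>e\<leftarrow>es. e ^ (2 * m))"
      by (rule member_le_sum_list) (use xs in \<open>auto simp: power_mult\<close>)
    also have "\<dots> \<le> (\<Sum>v\<in>{1..N}. real (D ^ (2 * m)))"
      unfolding pow by (intro sum_mono of_nat_mono D(1))
    finally have "\<bar>x\<bar> ^ (2 * m) \<le> N * real D ^ (2 * m)" by simp
    thus ?thesis using D(2) by (simp add: power_divide divide_le_eq)
  qed
  show "\<bar>x\<bar> \<le> real D"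
  proof (rule ccontr)
    assume "\<not> \<bar>x\<bar> \<le> real D"
    hence "\<bar>x\<bar> / D > 1" using D(2) by simp
    hence "(\<bar>x\<bar> / D)\<^sup>2 > 1" by (simp add: one_less_power)
    then obtain m where "real N < ((\<bar>x\<bar> / D)\<^sup>2) ^ m" using real_arch_pow by blast
    thus False using le[of m] by (simp add: power_mult)
  qed
qed

section \<open>Convergence of the moments\<close>

text \<open>The common support bound gives tightness, so Helly's theorem supplies a weak limit
  \<open>\<nu>\<close> of a subsequence. Weak convergence tests bounded continuous functions, so
  powers are composed with the truncation \<open>f\<close>, and the image of \<open>\<nu>\<close>
  under \<open>f\<close> is the measure sought.\<close>

lemma moment_limit_measure:
  fixes c :: "nat \<Rightarrow> real"
  assumes M: "\<And>n. real_distribution (M n)" and D: "D \<ge> 0"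
    and supp: "\<forall>\<^sub>F n in sequentially. AE x in M n. \<bar>x\<bar> \<le> D"
    and lim: "\<And>m. (\<lambda>n. LINT x|M n. x ^ m) \<longlonglongrightarrow> c m"
  shows "\<exists>\<mu>. real_distribution \<mu> \<and> (\<forall>m. integrable \<mu> (\<lambda>x. x ^ m) \<and> (LINT x|\<mu>. x ^ m) = c m)"
proof -
  obtain n0 where n0: "\<And>n. n \<ge> n0 \<Longrightarrow> AE x in M n. \<bar>x\<bar> \<le> D"
    using supp by (auto simp: eventually_sequentially)
  define M' where "M' n = M (n + n0)" for n
  have rd: "real_distribution (M' n)" for n using M by (simp add: M'_def)
  have AE: "AE x in M' n. \<bar>x\<bar> \<le> D" for n unfolding M'_def by (rule n0) simp
  have "tight M'" unfolding tight_def
  proof (intro conjI allI impI rd)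
    fix \<epsilon> :: real assume "\<epsilon> > 0"
    \<comment> \<open>The interval is open on the left, so it starts at \<open>- D - 1\<close> in
      order to include \<open>- D\<close>.\<close>
    have "measure (M' n) {- D - 1<..D} = 1" for n
    proof -
      interpret real_distribution "M' n" by (rule rd)
      have "AE x in M' n. x \<in> {- D - 1<..D}" using AE[of n] by eventually_elim auto
      thus ?thesis by (intro prob_eq_1[THEN iffD2]) auto
    qed
    thus "\<exists>a b. a < b \<and> (\<forall>n. 1 - \<epsilon> < measure (M' n) {a<..b})"
      using \<open>\<epsilon> > 0\<close> D by (intro exI[of _ "- D - 1"] exI[of _ D]) auto
  qed
  from tight_imp_convergent_subsubsequence[OF this strict_mono_id] obtain r \<nu> where
    r: "strict_mono r" and \<nu>: "real_distribution \<nu>" and conv: "weak_conv_m (M' \<circ> id \<circ> r) \<nu>"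
    by blast
  define f where "f x = max (- D) (min D x)" for x :: real
  have f_meas [measurable]: "f \<in> borel_measurable borel" unfolding f_def by measurable
  have f_bd: "\<bar>f x\<bar> \<le> D" for x using D by (auto simp: f_def)
  have f_bd': "norm (f x ^ m) \<le> D ^ m" for x m
    using f_bd[of x] by (simp add: power_abs power_mono)
  interpret \<nu>: real_distribution \<nu> by (rule \<nu>)
  have mom: "integral\<^sup>L \<nu> (\<lambda>x. f x ^ m) = c m" for m
  proof -
    have "(\<lambda>n. integral\<^sup>L ((M' \<circ> id \<circ> r) n) (\<lambda>x. f x ^ m)) \<longlonglongrightarrow> integral\<^sup>L \<nu> (\<lambda>x. f x ^ m)"
      by (rule weak_conv_imp_integral_bdd_continuous_conv[OF _ \<nu> conv, of _ "D ^ m"])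
         (use rd f_bd' in \<open>auto simp: f_def intro!: continuous_intros\<close>)
    \<comment> \<open>Under \<open>M' (r n)\<close> the truncation is almost surely the identity, so
      it does not change the moments.\<close>
    moreover have "integral\<^sup>L ((M' \<circ> id \<circ> r) n) (\<lambda>x. f x ^ m) = (LINT x|M (r n + n0). x ^ m)" for n
    proof -
      interpret real_distribution "M' (r n)" by (rule rd)
      have "integral\<^sup>L (M' (r n)) (\<lambda>x. f x ^ m) = (LINT x|M' (r n). x ^ m)"
        by (rule integral_cong_AE) (use AE[of "r n"] in \<open>auto simp: f_def elim!: eventually_mono\<close>)
      thus ?thesis by (simp add: M'_def)
    qed
    moreover have "(\<lambda>n. LINT x|M (r n + n0). x ^ m) \<longlonglongrightarrow> c m"
    proof (rule filterlim_compose[OF lim])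
      show "filterlim (\<lambda>n. r n + n0) sequentially sequentially"
        by (rule filterlim_subseq) (use r in \<open>auto simp: strict_mono_def\<close>)
    qed
    ultimately show ?thesis using LIMSEQ_unique by simp
  qed
  have int: "integrable \<nu> (\<lambda>x. f x ^ m)" for m
    by (rule \<nu>.integrable_const_bound[of _ "D ^ m"]) (use f_bd' in auto)
  have "real_distribution (distr \<nu> borel f)"
    by (simp add: real_distribution_def real_distribution_axioms_def \<nu>.prob_space_distr)
  moreover have "integrable (distr \<nu> borel f) (\<lambda>x. x ^ m) \<and> (LINT x|distr \<nu> borel f. x ^ m) = c m" for m
    using int[of m] mom[of m] by (simp add: integrable_distr_eq integral_distr)
  ultimately show ?thesis by blast
qed

section \<open>Moments of the random model and their limit\<close>

lemma real_distribution_expected: "real_distribution (expected_eigenvalue_distribution d k n)"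
  unfolding expected_eigenvalue_distribution_def real_distribution_def real_distribution_axioms_def
  by (simp add: measure_pmf.prob_space_distr)

text \<open>The bind averages over the regular graphs, so its moments are averages of the moments of
  single graphs. The support bound comes from \<open>card_closed_walks_distance_graph_le\<close>
  with \<open>D = d ^ k\<close>.\<close>

lemma expected_eigenvalue_distribution_properties:
  assumes d: "d \<ge> 1" and n: "n \<ge> d"
  defines "G \<equiv> regular_graphs d {1..2 * n}"
  shows "integrable (expected_eigenvalue_distribution d k n) (\<lambda>x. x ^ m)"
    and "(LINT x|expected_eigenvalue_distribution d k n. x ^ m) =
      (\<Sum>E\<in>G. (\<Sum>v\<in>{1..2 * n}. real (card (closed_walks {1..2 * n} (distance_graph k {1..2 * n} E) v m))) /
        (2 * n)) / card G"
    and "AE x in expected_eigenvalue_distribution d k n. \<bar>x\<bar> \<le> real (d ^ k)"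
proof -
  let ?V = "{1..2 * n}"
  let ?e = "\<lambda>E. eigenvalue_distribution (2 * n) (distance_graph k ?V E)"
  let ?p = "bind_pmf (pmf_of_set G) ?e"
  have G: "G \<noteq> {}" "finite G"
    using regular_graphs_nonempty[OF n] finite_regular_graphs[of ?V d] by (auto simp: G_def)
  have reg: "regular d ?V E" if "E \<in> G" for E
    using that by (simp add: G_def regular_graphs_def regular_def)
  have N: "2 * n > 0" using d n by simp
  have F: "expected_eigenvalue_distribution d k n = distr (measure_pmf ?p) borel (\<lambda>x. x)"
    by (simp add: expected_eigenvalue_distribution_def G_def regular_graphs_def)
  note fn = regular.finite_neighbours_distance_graph[OF reg]
  have fin: "finite (set_pmf (?e E))" if "E \<in> G" for E
    by (rule eigenvalue_distribution_moments(1)[OF N fn[OF that]])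
  have finp: "finite (set_pmf ?p)" using G fin by simp
  show "integrable (expected_eigenvalue_distribution d k n) (\<lambda>x. x ^ m)"
    unfolding F using integrable_measure_pmf_finite[OF finp, of "\<lambda>x. x ^ m"]
    by (simp add: integrable_distr_eq)
  have "(LINT x|expected_eigenvalue_distribution d k n. x ^ m) = measure_pmf.expectation ?p (\<lambda>x. x ^ m)"
    unfolding F by (subst integral_distr) auto
  also have "\<dots> = (\<Sum>E\<in>G. measure_pmf.expectation (?e E) (\<lambda>x. x ^ m) /\<^sub>R real (card G))"
    by (rule pmf_expectation_bind_pmf_of_set) (use G fin in auto)
  also have "\<dots> = (\<Sum>E\<in>G. measure_pmf.expectation (?e E) (\<lambda>x. x ^ m)) / card G"
    unfolding sum_divide_distrib by (rule sum.cong) (simp_all add: divide_inverse)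
  also have "(\<Sum>E\<in>G. measure_pmf.expectation (?e E) (\<lambda>x. x ^ m)) =
    (\<Sum>E\<in>G. (\<Sum>v\<in>?V. real (card (closed_walks ?V (distance_graph k ?V E) v m))) / (2 * n))"
    by (intro sum.cong refl eigenvalue_distribution_moments(2)[OF N] fn)
  finally show "(LINT x|expected_eigenvalue_distribution d k n. x ^ m) =
      (\<Sum>E\<in>G. (\<Sum>v\<in>?V. real (card (closed_walks ?V (distance_graph k ?V E) v m))) / (2 * n)) / card G" .
  have "\<bar>x\<bar> \<le> real (d ^ k)" if x: "x \<in> set_pmf ?p" for x
  proof -
    obtain E where E: "E \<in> G" "x \<in> set_pmf (?e E)" using x G by auto
    show ?thesis
      by (rule eigenvalue_distribution_moments(3)[OF N fn[OF E(1)] _ _ E(2)])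
         (use d regular.card_closed_walks_distance_graph_le[OF reg[OF E(1)]] in auto)
  qed
  thus "AE x in expected_eigenvalue_distribution d k n. \<bar>x\<bar> \<le> real (d ^ k)"
    unfolding F by (subst AE_distr_iff) (auto simp: AE_measure_pmf_iff)
qed

text \<open>The averaged closed-walk counts are compared with \<open>tree_moment\<close> vertex by
  vertex: a vertex with no short cycle nearby contributes \<open>0\<close>, any other at most
  \<open>C\<close>. The exceptional vertices number at most \<open>K\<close> on average over the
  graphs, so dividing by the number of vertices leaves order \<open>1 / n\<close>.\<close>

lemma expected_moment_deviation:
  assumes d: "d \<ge> 1" and n: "n \<ge> d" "2 * n \<ge> 4 * (2 * (k * m) + 1 + d)"
  shows "\<bar>(LINT x|expected_eigenvalue_distribution d k n. x ^ m) - tree_moment d k m\<bar> \<le>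
    ((d ^ k) ^ m + \<bar>tree_moment d k m\<bar>) * (2 * d * (\<Sum>l\<le>2 * (k * m) + 1. d ^ l)\<^sup>2) / n"
proof -
  let ?V = "{1..2 * n}" and ?L = "2 * (k * m) + 1" and ?c = "tree_moment d k m"
  let ?G = "regular_graphs d ?V"
  let ?h = "\<lambda>E v. real (card (closed_walks ?V (distance_graph k ?V E) v m))"
  let ?B = "\<lambda>E. {v\<in>?V. short_cycle_near ?V E ?L v}"
  define C where "C = real ((d ^ k) ^ m) + \<bar>?c\<bar>"
  define K where "K = 2 * d * (\<Sum>l\<le>2 * (k * m) + 1. d ^ l)\<^sup>2"
  have G: "card ?G > 0"
    using regular_graphs_nonempty[OF n(1)] finite_regular_graphs[of ?V d] by (simp add: card_gt_0_iff)
  have N: "2 * n > 0" using d n by simp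
  have C0: "C \<ge> 0" by (simp add: C_def)
  have one: "\<bar>(\<Sum>v\<in>?V. ?h E v) / (2 * n) - ?c\<bar> \<le> C * card (?B E) / (2 * n)" if "E \<in> ?G" for E
  proof -
    interpret regular d ?V E using that by (simp add: regular_graphs_def regular_def)
    have "(\<Sum>v\<in>?V. ?h E v - ?c) = (\<Sum>v\<in>?V. ?h E v) - 2 * n * ?c"
      unfolding sum_subtractf by simp
    hence "(\<Sum>v\<in>?V. ?h E v) / (2 * n) - ?c = (\<Sum>v\<in>?V. ?h E v - ?c) / (2 * n)"
      using N by (simp only: diff_divide_distrib) simp
    moreover have "\<bar>\<Sum>v\<in>?V. ?h E v - ?c\<bar> \<le> C * card (?B E)"
    proof -
      have eq: "(\<Sum>v\<in>?V. ?h E v - ?c) = (\<Sum>v\<in>?B E. ?h E v - ?c)"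
      proof (rule sum.mono_neutral_right)
        show "\<forall>v\<in>?V - ?B E. ?h E v - ?c = 0"
          using card_closed_walks_distance_graph by simp
      qed auto
      have "\<bar>\<Sum>v\<in>?V. ?h E v - ?c\<bar> \<le> (\<Sum>v\<in>?B E. \<bar>?h E v - ?c\<bar>)"
        unfolding eq by (rule sum_abs)
      also have "\<dots> \<le> (\<Sum>v\<in>?B E. C)"
      proof (rule sum_mono)
        fix v assume "v \<in> ?B E"
        hence "v \<in> ?V" by blast
        hence "?h E v \<le> real ((d ^ k) ^ m)"
          by (rule of_nat_mono[OF card_closed_walks_distance_graph_le])
        thus "\<bar>?h E v - ?c\<bar> \<le> C" unfolding C_def by linarith
      qed
      finally show ?thesis by (simp add: mult.commute)
    qed
    ultimately show ?thesis using N by (simp add: abs_divide divide_right_mono)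
  qed
  have "(\<Sum>E\<in>?G. (\<Sum>v\<in>?V. ?h E v) / (2 * n) - ?c) =
      (\<Sum>E\<in>?G. (\<Sum>v\<in>?V. ?h E v) / (2 * n)) - card ?G * ?c"
    unfolding sum_subtractf by simp
  hence eq: "(LINT x|expected_eigenvalue_distribution d k n. x ^ m) - ?c =
      (\<Sum>E\<in>?G. (\<Sum>v\<in>?V. ?h E v) / (2 * n) - ?c) / card ?G"
    unfolding expected_eigenvalue_distribution_properties(2)[OF d n(1)]
    using G by (simp only: diff_divide_distrib) simp
  have bad: "(\<Sum>E\<in>?G. card (?B E)) \<le> card ?G * K"
    unfolding K_def by (rule sum_card_short_cycle_near_le) (use d n(2) in simp_all)
  have "\<bar>\<Sum>E\<in>?G. (\<Sum>v\<in>?V. ?h E v) / (2 * n) - ?c\<bar> \<le> (\<Sum>E\<in>?G. C * card (?B E) / (2 * n))"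
    by (rule order_trans[OF sum_abs sum_mono[OF one]])
  also have "\<dots> = C * real (\<Sum>E\<in>?G. card (?B E)) / (2 * n)"
    by (simp only: of_nat_sum sum_distrib_left sum_divide_distrib)
  also have "\<dots> \<le> C * real (card ?G * K) / (2 * n)"
    using bad C0 by (intro divide_right_mono mult_left_mono) (simp_all only: of_nat_le_iff of_nat_0_le_iff)
  also have "\<dots> \<le> C * real (card ?G * K) / n"
    using C0 N by (intro divide_left_mono) auto
  finally have "\<bar>\<Sum>E\<in>?G. (\<Sum>v\<in>?V. ?h E v) / (2 * n) - ?c\<bar> / card ?G \<le> C * real K / n"
    using G by (simp add: divide_le_eq mult_ac)
  hence "\<bar>(LINT x|expected_eigenvalue_distribution d k n. x ^ m) - ?c\<bar> \<le> C * real K / n"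
    unfolding eq abs_divide abs_of_nat .
  thus ?thesis by (simp add: C_def K_def)
qed

theorem theorem1p5:
  fixes d k :: nat and V :: "'v set" and T :: "'v set set" and r :: 'v
  assumes "d \<ge> 1" and "k \<ge> 1"
    and "regular_tree d V T" and "r \<in> V"
  shows "\<exists>\<mu>. vacuum_distribution V (distance_graph k V T) r \<mu> \<and>
             converges_in_moments (expected_eigenvalue_distribution d k) \<mu>"
proof -
  let ?F = "expected_eigenvalue_distribution d k"
  interpret regular d V T using assms(3) by (simp add: regular_def regular_tree_def)
  \<comment> \<open>A tree has no cycles at all, so the universal count holds at \<open>r\<close>
    for every \<open>m\<close>.\<close>
  have tree: "real (card (closed_walks V (distance_graph k V T) r m)) = tree_moment d k m" for m
    using assms by (intro card_closed_walks_distance_graph acyclic_no_short_cycle)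
      (simp_all add: regular_tree_def)
  have lim: "(\<lambda>n. LINT x|?F n. x ^ m) \<longlonglongrightarrow> tree_moment d k m" for m
  proof -
    define K where "K = ((d ^ k) ^ m + \<bar>tree_moment d k m\<bar>) * (2 * d * (\<Sum>l\<le>2 * (k * m) + 1. d ^ l)\<^sup>2)"
    have "(\<lambda>n. (LINT x|?F n. x ^ m) - tree_moment d k m) \<longlonglongrightarrow> 0"
    proof (rule Lim_null_comparison)
      show "(\<lambda>n. K / real n) \<longlonglongrightarrow> 0" by (rule lim_const_over_n)
      \<comment> \<open>From \<open>n \<ge> 2 * (L + d)\<close> with
        \<open>L = 2 * (k * m) + 1\<close> both conditions on \<open>n\<close> in
        \<open>expected_moment_deviation\<close> follow.\<close>
      show "\<forall>\<^sub>F n in sequentially. norm ((LINT x|?F n. x ^ m) - tree_moment d k m) \<le> K / real n"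
        using eventually_ge_at_top[of "2 * (2 * (k * m) + 1 + d)"]
      proof eventually_elim
        case (elim n)
        thus ?case using expected_moment_deviation[OF assms(1), of n k m] by (simp add: K_def)
      qed
    qed
    thus ?thesis by (simp add: LIM_zero_iff)
  qed
  have supp: "\<forall>\<^sub>F n in sequentially. AE x in ?F n. \<bar>x\<bar> \<le> real (d ^ k)"
    using eventually_ge_at_top[of d]
    by eventually_elim (rule expected_eigenvalue_distribution_properties(3)[OF assms(1)])
  obtain \<mu> where \<mu>: "real_distribution \<mu>"
    "\<And>m. integrable \<mu> (\<lambda>x. x ^ m) \<and> (LINT x|\<mu>. x ^ m) = tree_moment d k m"
    using moment_limit_measure[OF real_distribution_expected _ supp lim] by auto
  have "\<forall>\<^sub>F n in sequentially. integrable (?F n) (\<lambda>x. x ^ m)" for m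
    using eventually_ge_at_top[of d]
    by eventually_elim (rule expected_eigenvalue_distribution_properties(1)[OF assms(1)])
  thus ?thesis using \<mu> lim tree
    by (intro exI[of _ \<mu>]) (simp add: vacuum_distribution_def converges_in_moments_def)
qed

end
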